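(* Let $\overline{E}[\cdot]=\sup_{P\in\mathcal{P}}E_P[\cdot]$ be a sublinear expectation on the space $(\Omega,\mathcal{H},\overline{E})$ described in the context. Let $\{X_i\}_{i=1}^\infty\subset\mathcal{H}$ be a sequence of random variables that is IID under $\overline{E}$, and assume that $\overline{E}[X_1]=\overline{E}[-X_1]=0$. Put $\overline{S}_n:=\frac{1}{\sqrt{n}}\sum_{i=1}^n X_i$. Let $\xi$ be a random variable that is $G$-normally distributed, $\xi\sim\mathcal{N}(0;[\underline{\sigma}^2,\overline{\sigma}^2])$, under a sublinear expectation $\widetilde{E}$, with $\overline{\sigma}^2=\overline{E}[X_1^2]$ and $\underline{\sigma}^2=-\overline{E}[-X_1^2]$. Then $\{\overline{S}_n\}_{n=1}^\infty$ converges in law to $\xi$ in the sense that $$\lim_{n\to\infty}\overline{E}[\varphi(\overline{S}_n)]=\widetilde{E}[\varphi(\xi)]$$ for any continuous function $\varphi:\mathbb{R}\to\mathbb{R}$ satisfying the growth condition $|\varphi(x)|\le C(1+|x|^p)$ for all $x\in\mathbb{R}$, for some $C>0$ and $p\ge1$ depending on $\varphi$.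
   Context: Setting. $(\Omega,\mathcal{F})$ is a measurable space, $\mathcal{P}$ is a nonempty set of probability measures on it, and $E_P$ denotes the classical expectation under $P$. $\mathcal{H}$ is a linear space of real-valued random variables on $(\Omega,\mathcal{F})$ that contains all constants, satisfies $|X|\in\mathcal{H}$ whenever $X\in\mathcal{H}$, and satisfies: if $X_1,\dots,X_n\in\mathcal{H}$ then $\varphi(X_1,\dots,X_n)\in\mathcal{H}$ for each $\varphi\in C_{l,Lip}(\mathbb{R}^n)$. Here $C_{l,Lip}(\mathbb{R}^n)$ is the space of functions $\varphi:\mathbb{R}^n\to\mathbb{R}$ such that $|\varphi(x)-\varphi(y)|\le C(1+|x|^m+|y|^m)|x-y|$ for all $x,y\in\mathbb{R}^n$, for some $C>0$ and $m\in\mathbb{N}$ depending on $\varphi$. The functional $\overline{E}[\xi]:=\sup_{P\in\mathcal{P}}E_P[\xi]$ is assumed to be real-valued (finite) on $\mathcal{H}$; it is a sublinear expectation, i.e. it is monotone, constant preserving, sub-additive ($\overline{E}[X]-\overline{E}[Y]\le\overline{E}[X-Y]$) and positively homogeneous. The formula $\sup_{P\in\mathcal{P}}E_P[\cdot]$ also defines $\overline{E}$ on every random variable whose absolute value is bounded by an element of $\mathcal{H}$; this gives meaning to $\overline{E}[\varphi(\overline{S}_n)]$. The sublinear expectation $\widetilde{E}$ is of the same type (a supremum of classical expectations over a nonempty set of probability measures on some measurable space, finite on a space of random variables with the same closure properties that contains $\xi$), and $\widetilde{E}[\varphi(\xi)]$ is understood in the same way. Independence. For $Y_1,\dots,Y_n\in\mathcal{H}$,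 the random variable $Y_n$ is said to be independent of $X:=(Y_1,\dots,Y_{n-1})$ under $\overline{E}$ if for each measurable function $\varphi$ on $\mathbb{R}^n$ with $\varphi(X,Y_n)\in\mathcal{H}$ and $\varphi(x,Y_n)\in\mathcal{H}$ for each $x\in\mathbb{R}^{n-1}$, one has $\overline{E}[\varphi(X,Y_n)]=\overline{E}[\overline{\varphi}(X)]$, where $\overline{\varphi}(x):=\overline{E}[\varphi(x,Y_n)]$ and $\overline{\varphi}(X)\in\mathcal{H}$. Identical distribution. $X,Y\in\mathcal{H}$ are identically distributed, $X\sim Y$, if $\overline{E}[\varphi(X)]=\overline{E}[\varphi(Y)]$ for each measurable function $\varphi$ such that $\varphi(X),\varphi(Y)\in\mathcal{H}$. IID. A sequence $\{X_i\}_{i=1}^\infty$ is IID under $\overline{E}$ if $X_i\sim X_1$ and $X_{i+1}$ is independent of $(X_1,\dots,X_i)$ for each $i\ge1$. $G$-normal distribution. A random variable $\xi$ under a sublinear expectation $\widetilde{E}$, with $\overline{\sigma}^2=\widetilde{E}[\xi^2]$ and $\underline{\sigma}^2=-\widetilde{E}[-\xi^2]$, is called $G$-normally distributed, written $\mathcal{N}(0;[\underline{\sigma}^2,\overline{\sigma}^2])$, if for any $\varphi\in C_{l,Lip}(\mathbb{R})$ the function $u(t,x):=\widetilde{E}[\varphi(x+\sqrt{t}\,\xi)]$, $(t,x)\in[0,\infty)\times\mathbb{R}$, is the unique viscosity solution of the PDE $$\partial_t u-G(\partial^2_{xx}u)=0,\qquad u(0,x)=\varphi(x),$$ where $G(x):=\frac12(\overline{\sigma}^2x^+-\underline{\sigma}^2x^-)$,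 $x^+:=\max\{x,0\}$, $x^-:=(-x)^+$. *)

theory Defs
  imports "HOL-Probability.Probability"
begin

text \<open>
  The space \<open>\<real>\<^sup>n\<close> for a variable \<open>n\<close> is the carrier of
  \<open>Pi\<^sub>M {1..n} (\<lambda>_. borel)\<close>: its points are the extensional functions on \<open>{1..n}\<close>,
  and the Euclidean norm of \<open>x\<close> is \<open>L2_set x {1..n}\<close>.
\<close>

abbreviation Rn :: "nat \<Rightarrow> (nat \<Rightarrow> real) measure" where
  "Rn n \<equiv> Pi\<^sub>M {1..n} (\<lambda>_. borel)"

definition C_lLip_n :: "nat \<Rightarrow> ((nat \<Rightarrow> real) \<Rightarrow> real) \<Rightarrow> bool" where
  "C_lLip_n n \<phi> \<longleftrightarrow>
     (\<exists>C>0. \<exists>m::nat. \<forall>x\<in>space (Rn n). \<forall>y\<in>space (Rn n).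
        \<bar>\<phi> x - \<phi> y\<bar> \<le> C * (1 + L2_set x {1..n} ^ m + L2_set y {1..n} ^ m)
                          * L2_set (\<lambda>i. x i - y i) {1..n})"

definition C_lLip :: "(real \<Rightarrow> real) \<Rightarrow> bool" where
  "C_lLip \<phi> \<longleftrightarrow>
     (\<exists>C>0. \<exists>m::nat. \<forall>x y. \<bar>\<phi> x - \<phi> y\<bar> \<le> C * (1 + \<bar>x\<bar> ^ m + \<bar>y\<bar> ^ m) * \<bar>x - y\<bar>)"


text \<open>
  The value is meaningful for functions that are integrable under every \<open>P \<in> \<P>\<close> with
  integrals bounded above uniformly in \<open>P\<close>; see \<open>dominated\<close> below.
\<close>

definition upper_expectation :: "'a measure set \<Rightarrow> ('a \<Rightarrow> real) \<Rightarrow> real" where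
  "upper_expectation \<P> X = (SUP P\<in>\<P>. integral\<^sup>L P X)"

text \<open>
  Only the measurable space underlying \<open>M\<close> is used, not its measure.  The assumptions
  \<open>integrable\<close> and \<open>bdd_above\<close> say that the upper expectation is real-valued on \<open>H\<close>.
\<close>

locale sublinear_expectation_space =
  fixes M :: "'a measure" and \<P> :: "'a measure set" and H :: "('a \<Rightarrow> real) set"
  assumes nonempty: "\<P> \<noteq> {}"
    and prob_space: "P \<in> \<P> \<Longrightarrow> prob_space P"
    and sets_eq: "P \<in> \<P> \<Longrightarrow> sets P = sets M"
    and random_variable: "X \<in> H \<Longrightarrow> X \<in> borel_measurable M"
    and const: "(\<lambda>_. c) \<in> H"
    and add: "X \<in> H \<Longrightarrow> Y \<in> H \<Longrightarrow> (\<lambda>\<omega>. X \<omega> + Y \<omega>) \<in> H"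
    and scale: "X \<in> H \<Longrightarrow> (\<lambda>\<omega>. c * X \<omega>) \<in> H"
    and abs: "X \<in> H \<Longrightarrow> (\<lambda>\<omega>. \<bar>X \<omega>\<bar>) \<in> H"
    and C_lLip_closed: "(\<And>i. i \<in> {1..n} \<Longrightarrow> Z i \<in> H) \<Longrightarrow> C_lLip_n n \<phi> \<Longrightarrow>
           (\<lambda>\<omega>. \<phi> (\<lambda>i\<in>{1..n}. Z i \<omega>)) \<in> H"
    and integrable: "X \<in> H \<Longrightarrow> P \<in> \<P> \<Longrightarrow> integrable P X"
    and bdd_above: "X \<in> H \<Longrightarrow> bdd_above ((\<lambda>P. integral\<^sup>L P X) ` \<P>)"
begin

lemma dominated:
  assumes X: "X \<in> borel_measurable M" and Y: "Y \<in> H"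
    and le: "\<And>\<omega>. \<omega> \<in> space M \<Longrightarrow> \<bar>X \<omega>\<bar> \<le> Y \<omega>"
  shows "P \<in> \<P> \<Longrightarrow> integrable P X"
    and "bdd_above ((\<lambda>P. integral\<^sup>L P X) ` \<P>)"
proof -
  have space: "space P = space M" if "P \<in> \<P>" for P
    using sets_eq[OF that] by (rule sets_eq_imp_space_eq)
  show int: "integrable P X" if P: "P \<in> \<P>" for P
  proof (rule Bochner_Integration.integrable_bound[OF integrable[OF Y P]])
    show "X \<in> borel_measurable P"
      using X sets_eq[OF P] by (simp cong: measurable_cong_sets)
    show "AE \<omega> in P. norm (X \<omega>) \<le> norm (Y \<omega>)"
      using le space[OF P] by (intro AE_I2) (metis abs_ge_self order_trans real_norm_def)
  qed
  obtain B where B: "\<And>P. P \<in> \<P> \<Longrightarrow> integral\<^sup>L P Y \<le> B"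
    using bdd_above[OF Y] by (auto simp: bdd_above_def)
  have "integral\<^sup>L P X \<le> B" if P: "P \<in> \<P>" for P
  proof -
    have "integral\<^sup>L P X \<le> integral\<^sup>L P Y"
      using le space[OF P]
      by (intro integral_mono int[OF P] integrable[OF Y P]) (metis abs_ge_self order_trans)
    with B[OF P] show ?thesis by simp
  qed
  then show "bdd_above ((\<lambda>P. integral\<^sup>L P X) ` \<P>)"
    by (auto simp: bdd_above_def)
qed

end


definition identically_distributed ::
  "'a measure set \<Rightarrow> ('a \<Rightarrow> real) set \<Rightarrow> ('a \<Rightarrow> real) \<Rightarrow> ('a \<Rightarrow> real) \<Rightarrow> bool" where
  "identically_distributed \<P> H X Y \<longleftrightarrow>
     (\<forall>\<phi>\<in>borel_measurable borel.
        (\<lambda>\<omega>. \<phi> (X \<omega>)) \<in> H \<and> (\<lambda>\<omega>. \<phi> (Y \<omega>)) \<in> H \<longrightarrow>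
        upper_expectation \<P> (\<lambda>\<omega>. \<phi> (X \<omega>)) = upper_expectation \<P> (\<lambda>\<omega>. \<phi> (Y \<omega>)))"

text \<open>
  \<open>Z\<close> is independent of \<open>(Y 1, \<dots>, Y k)\<close>.  A point \<open>(x, z)\<close> of \<open>\<real>\<^sup>k\<^sup>+\<^sup>1\<close> is
  \<open>x(Suc k := z)\<close>.  That \<open>\<phi>bar(Y 1, \<dots>, Y k)\<close> belongs to \<open>H\<close> is part of what independence asserts.
\<close>

definition independent_of ::
  "'a measure set \<Rightarrow> ('a \<Rightarrow> real) set \<Rightarrow> ('a \<Rightarrow> real) \<Rightarrow> nat \<Rightarrow> (nat \<Rightarrow> 'a \<Rightarrow> real) \<Rightarrow> bool" where
  "independent_of \<P> H Z k Y \<longleftrightarrow>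
     (\<forall>\<phi>\<in>borel_measurable (Rn (Suc k)).
        (\<lambda>\<omega>. \<phi> ((\<lambda>i\<in>{1..k}. Y i \<omega>)(Suc k := Z \<omega>))) \<in> H \<and>
        (\<forall>x\<in>space (Rn k). (\<lambda>\<omega>. \<phi> (x(Suc k := Z \<omega>))) \<in> H) \<longrightarrow>
        (let \<phi>bar = (\<lambda>x. upper_expectation \<P> (\<lambda>\<omega>. \<phi> (x(Suc k := Z \<omega>)))) in
           (\<lambda>\<omega>. \<phi>bar (\<lambda>i\<in>{1..k}. Y i \<omega>)) \<in> H \<and>
           upper_expectation \<P> (\<lambda>\<omega>. \<phi> ((\<lambda>i\<in>{1..k}. Y i \<omega>)(Suc k := Z \<omega>))) =
           upper_expectation \<P> (\<lambda>\<omega>. \<phi>bar (\<lambda>i\<in>{1..k}. Y i \<omega>))))"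

text \<open>Sequences are indexed from \<open>1\<close>; the term \<open>X 0\<close> plays no role.\<close>

definition iid ::
  "'a measure set \<Rightarrow> ('a \<Rightarrow> real) set \<Rightarrow> (nat \<Rightarrow> 'a \<Rightarrow> real) \<Rightarrow> bool" where
  "iid \<P> H X \<longleftrightarrow>
     (\<forall>i\<ge>1. identically_distributed \<P> H (X i) (X 1) \<and> independent_of \<P> H (X (Suc i)) i X)"


definition G_fun :: "real \<Rightarrow> real \<Rightarrow> real \<Rightarrow> real" where
  "G_fun var_lo var_hi x = (var_hi * max x 0 - var_lo * max (- x) 0) / 2"

text \<open>\<open>\<psi>\<close> is of class \<open>C\<^sup>1\<^sup>,\<^sup>2\<close> on \<open>(0,\<infinity>) \<times> \<real>\<close>, with \<open>\<psi>t\<close>, \<open>\<psi>x\<close>, \<open>\<psi>xx\<close> its partial derivatives.\<close>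

definition C12_derivs ::
  "(real \<times> real \<Rightarrow> real) \<Rightarrow> (real \<times> real \<Rightarrow> real) \<Rightarrow> (real \<times> real \<Rightarrow> real)
     \<Rightarrow> (real \<times> real \<Rightarrow> real) \<Rightarrow> bool" where
  "C12_derivs \<psi> \<psi>t \<psi>x \<psi>xx \<longleftrightarrow>
     (\<forall>t>0. \<forall>x.
        ((\<lambda>s. \<psi> (s, x)) has_real_derivative \<psi>t (t, x)) (at t) \<and>
        ((\<lambda>y. \<psi> (t, y)) has_real_derivative \<psi>x (t, x)) (at x) \<and>
        ((\<lambda>y. \<psi>x (t, y)) has_real_derivative \<psi>xx (t, x)) (at x)) \<and>
     continuous_on ({0<..} \<times> UNIV) \<psi> \<and> continuous_on ({0<..} \<times> UNIV) \<psi>t \<and>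
     continuous_on ({0<..} \<times> UNIV) \<psi>x \<and> continuous_on ({0<..} \<times> UNIV) \<psi>xx"

definition viscosity_subsolution :: "(real \<Rightarrow> real) \<Rightarrow> (real \<times> real \<Rightarrow> real) \<Rightarrow> bool" where
  "viscosity_subsolution G u \<longleftrightarrow>
     (\<forall>t>0. \<forall>x. \<forall>\<psi> \<psi>t \<psi>x \<psi>xx. C12_derivs \<psi> \<psi>t \<psi>x \<psi>xx \<and>
        (\<forall>\<^sub>F z in nhds (t, x). u z - \<psi> z \<le> u (t, x) - \<psi> (t, x)) \<longrightarrow>
        \<psi>t (t, x) - G (\<psi>xx (t, x)) \<le> 0)"

definition viscosity_supersolution :: "(real \<Rightarrow> real) \<Rightarrow> (real \<times> real \<Rightarrow> real) \<Rightarrow> bool" where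
  "viscosity_supersolution G u \<longleftrightarrow>
     (\<forall>t>0. \<forall>x. \<forall>\<psi> \<psi>t \<psi>x \<psi>xx. C12_derivs \<psi> \<psi>t \<psi>x \<psi>xx \<and>
        (\<forall>\<^sub>F z in nhds (t, x). u z - \<psi> z \<ge> u (t, x) - \<psi> (t, x)) \<longrightarrow>
        \<psi>t (t, x) - G (\<psi>xx (t, x)) \<ge> 0)"

text \<open>Only the values of \<open>u\<close> on \<open>[0,\<infinity>) \<times> \<real>\<close> matter.\<close>

definition viscosity_solution ::
  "(real \<Rightarrow> real) \<Rightarrow> (real \<Rightarrow> real) \<Rightarrow> (real \<times> real \<Rightarrow> real) \<Rightarrow> bool" where
  "viscosity_solution G \<phi> u \<longleftrightarrow>
     continuous_on ({0..} \<times> UNIV) u \<and> (\<forall>x. u (0, x) = \<phi> x) \<and>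
     viscosity_subsolution G u \<and> viscosity_supersolution G u"

definition polynomial_growth :: "(real \<times> real \<Rightarrow> real) \<Rightarrow> bool" where
  "polynomial_growth u \<longleftrightarrow>
     (\<forall>T\<ge>0. \<exists>C>0. \<exists>m::nat. \<forall>t\<in>{0..T}. \<forall>x. \<bar>u (t, x)\<bar> \<le> C * (1 + \<bar>x\<bar> ^ m))"

text \<open>
  Uniqueness is meant, as usual for this equation, among functions of polynomial growth in \<open>x\<close>,
  locally uniformly in \<open>t\<close>.  Without a growth restriction it already fails for the heat equation
  (Tychonoff).
\<close>

definition unique_viscosity_solution ::
  "(real \<Rightarrow> real) \<Rightarrow> (real \<Rightarrow> real) \<Rightarrow> (real \<times> real \<Rightarrow> real) \<Rightarrow> bool" where
  "unique_viscosity_solution G \<phi> u \<longleftrightarrow>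
     viscosity_solution G \<phi> u \<and> polynomial_growth u \<and>
     (\<forall>v. viscosity_solution G \<phi> v \<and> polynomial_growth v \<longrightarrow> (\<forall>t\<ge>0. \<forall>x. v (t, x) = u (t, x)))"

text \<open>\<open>\<xi> \<sim> N(0; [var_lo, var_hi])\<close> under the upper expectation of \<open>\<Q>\<close>.\<close>

definition G_normal ::
  "'b measure set \<Rightarrow> ('b \<Rightarrow> real) \<Rightarrow> real \<Rightarrow> real \<Rightarrow> bool" where
  "G_normal \<Q> \<xi> var_lo var_hi \<longleftrightarrow>
     var_hi = upper_expectation \<Q> (\<lambda>\<omega>. (\<xi> \<omega>)\<^sup>2) \<and>
     var_lo = - upper_expectation \<Q> (\<lambda>\<omega>. - (\<xi> \<omega>)\<^sup>2) \<and>
     (\<forall>\<phi>. C_lLip \<phi> \<longrightarrow>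
        unique_viscosity_solution (G_fun var_lo var_hi) \<phi>
          (\<lambda>(t, x). upper_expectation \<Q> (\<lambda>\<omega>. \<phi> (x + sqrt t * \<xi> \<omega>))))"

end

theory Submission
  imports Defs "HOL-Complex_Analysis.Great_Picard"
begin

text \<open>
  The distribution of \<open>\<xi>\<close> is characterised by a parabolic equation with a unique viscosity solution,
  so it suffices to show that the laws of the normalised sums are asymptotically governed by that
  equation. The route is compactness of the approximations together with this uniqueness.

  Let \<open>f\<close> be bounded and Lipschitz, put \<open>S\<^sub>k = X\<^sub>1 + \<dots> + X\<^sub>k\<close>, and consider
  \<open>V\<^sub>n(t, x) = E[f(x + S\<^sub>k / sqrt n)]\<close> with \<open>k = \<lfloor>n t\<rfloor>\<close>. Independence and identical distribution make
  \<open>f \<mapsto> E[f(x + s S\<^sub>k)]\<close> a semigroup in \<open>k\<close> (\<open>W_add\<close>), which is a dynamic programming principle for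
  \<open>V\<^sub>n\<close>. Since the \<open>X\<^sub>i\<close> have no mean uncertainty, \<open>E[S\<^sub>k\<^sup>2]\<close> grows linearly in \<open>k\<close>, so \<open>V\<^sub>n\<close> is
  Lipschitz in \<open>x\<close> and, up to the time step \<open>1/n\<close>, 1/2-Hoelder in \<open>t\<close> (\<open>V_modulus\<close>). As in the
  Arzela-Ascoli theorem, every subsequence has a further subsequence along which \<open>V\<^sub>n\<close> converges to
  some continuous \<open>v\<close>, and dynamic programming passes to the limit:
  \<open>v(t, x) = lim E[v(t - \<delta>, x + S\<^sub>k / sqrt n)]\<close> with \<open>k / n \<rightarrow> \<delta>\<close> (\<open>v_dynamic_programming\<close>).

  A smooth function touching \<open>v\<close> from above at \<open>(t, x)\<close> gives, for all \<open>y\<close>, a bound of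
  \<open>v(t - \<delta>, x + y)\<close> by a quadratic polynomial in \<open>y\<close> plus \<open>K y\<^sup>4\<close>. On quadratic polynomials the
  semigroup acts explicitly, with generator \<open>G\<close> (\<open>E_quadratic\<close>), while
  \<open>E[(S\<^sub>k / sqrt n)\<^sup>4] = O(\<delta>\<^sup>2)\<close> (\<open>E_even_power\<close>); dividing by \<open>\<delta>\<close> and letting \<open>\<delta> \<rightarrow> 0\<close> yields the
  viscosity inequality. Hence \<open>v\<close> is the unique viscosity solution with initial value \<open>f\<close>, whichever
  subsequence was chosen, and \<open>V\<^sub>n(1, 0)\<close> converges to its value at \<open>(1, 0)\<close>, which is the upper
  expectation of \<open>f(\<xi>)\<close>.

  A continuous \<open>\<phi>\<close> of polynomial growth differs from a bounded Lipschitz function by at most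
  \<open>\<epsilon> (1 + |x|\<^sup>2\<^sup>q)\<close> for suitable \<open>q\<close> and arbitrarily small \<open>\<epsilon>\<close>
  (\<open>bounded_Lipschitz_approximation\<close>), and the moments of order \<open>2 q\<close> of the normalised sums are
  bounded, so convergence extends to \<open>\<phi>\<close>.
\<close>

section \<open>Real functions and sequences\<close>

lemma C_lLip_Lipschitz:
  assumes "\<And>x y. \<bar>f x - f y\<bar> \<le> L * \<bar>x - y\<bar>"
  shows "C_lLip f"
  unfolding C_lLip_def
proof (intro exI[of _ "\<bar>L\<bar> + 1"] conjI exI[of _ "0::nat"] allI)
  fix x y :: real
  have "L * \<bar>x - y\<bar> \<le> (\<bar>L\<bar> + 1) * 3 * \<bar>x - y\<bar>"
    by (intro mult_right_mono) auto
  with assms[of x y] show "\<bar>f x - f y\<bar> \<le> (\<bar>L\<bar> + 1) * (1 + \<bar>x\<bar> ^ 0 + \<bar>y\<bar> ^ 0) * \<bar>x - y\<bar>"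
    by simp
qed auto

definition bounded_Lipschitz :: "real \<Rightarrow> real \<Rightarrow> (real \<Rightarrow> real) \<Rightarrow> bool" where
  "bounded_Lipschitz L B f \<longleftrightarrow>
     (\<forall>x y. \<bar>f x - f y\<bar> \<le> L * \<bar>x - y\<bar>) \<and> (\<forall>x. \<bar>f x\<bar> \<le> B)"

lemma bounded_LipschitzD:
  assumes "bounded_Lipschitz L B f"
  shows "\<bar>f x - f y\<bar> \<le> L * \<bar>x - y\<bar>" "\<bar>f x\<bar> \<le> B" "0 \<le> L" "0 \<le> B" "C_lLip f"
proof -
  show *: "\<bar>f x - f y\<bar> \<le> L * \<bar>x - y\<bar>" "\<bar>f x\<bar> \<le> B" for x y
    using assms unfolding bounded_Lipschitz_def by auto
  show "0 \<le> L" using *(1)[of 1 0] by simp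
  show "0 \<le> B" using *(2)[of 0] by linarith
  show "C_lLip f" using *(1) by (rule C_lLip_Lipschitz)
qed

text \<open>
  Each of the \<open>n + 1\<close> summands of the factor complementary to \<open>x - y\<close> is at most the \<open>n\<close>-th power of
  the larger of \<open>|x|\<close> and \<open>|y|\<close>.
\<close>

lemma power_diff_bound:
  fixes x y :: real
  shows "\<bar>x ^ Suc n - y ^ Suc n\<bar> \<le> real (Suc n) * (1 + \<bar>x\<bar> ^ n + \<bar>y\<bar> ^ n) * \<bar>x - y\<bar>"
proof -
  have "\<bar>x ^ i * y ^ (n - i)\<bar> \<le> 1 + \<bar>x\<bar> ^ n + \<bar>y\<bar> ^ n" if "i < Suc n" for i
  proof -
    define m where "m = max \<bar>x\<bar> \<bar>y\<bar>"
    have "\<bar>x\<bar> ^ i * \<bar>y\<bar> ^ (n - i) \<le> m ^ i * m ^ (n - i)"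
      unfolding m_def by (intro mult_mono power_mono) auto
    also have "\<dots> = m ^ n" using that by (simp flip: power_add)
    also have "\<dots> \<le> 1 + \<bar>x\<bar> ^ n + \<bar>y\<bar> ^ n" by (auto simp: m_def max_def)
    finally show ?thesis by (simp add: abs_mult power_abs)
  qed
  then have "(\<Sum>i<Suc n. \<bar>x ^ i * y ^ (n - i)\<bar>) \<le> (\<Sum>i<Suc n. 1 + \<bar>x\<bar> ^ n + \<bar>y\<bar> ^ n)"
    by (intro sum_mono) auto
  then have *: "\<bar>\<Sum>i<Suc n. x ^ i * y ^ (n - i)\<bar> \<le> real (Suc n) * (1 + \<bar>x\<bar> ^ n + \<bar>y\<bar> ^ n)"
    using sum_abs[of "\<lambda>i. x ^ i * y ^ (n - i)" "{..<Suc n}"]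
    by (simp only: sum_constant card_lessThan of_nat_Suc)
  have "x ^ Suc n - y ^ Suc n = (x - y) * (\<Sum>i<Suc n. x ^ i * y ^ (n - i))"
    using power_diff_sumr2[of x "Suc n" y] by (simp add: mult.commute)
  then show ?thesis
    using mult_right_mono[OF *, of "\<bar>x - y\<bar>"] by (simp add: abs_mult mult.commute)
qed

lemma C_lLip_power: "C_lLip (\<lambda>x. x ^ n)"
proof (cases n)
  case 0
  then show ?thesis by (intro C_lLip_Lipschitz[where L=0]) simp
next
  case (Suc k)
  show ?thesis unfolding C_lLip_def Suc
    using power_diff_bound by (intro exI[of _ "real (Suc k)"] conjI exI[of _ k] allI) auto
qed

lemma C_lLip_continuous:
  assumes "C_lLip f" shows "continuous_on UNIV f"
proof -
  obtain C m where C: "\<And>x y. \<bar>f x - f y\<bar> \<le> C * (1 + \<bar>x\<bar> ^ m + \<bar>y\<bar> ^ m) * \<bar>x - y\<bar>"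
    using assms unfolding C_lLip_def by metis
  have "isCont f x" for x
  proof -
    have "((\<lambda>y. C * (1 + \<bar>y\<bar> ^ m + \<bar>x\<bar> ^ m) * \<bar>y - x\<bar>) \<longlongrightarrow> C * (1 + \<bar>x\<bar> ^ m + \<bar>x\<bar> ^ m) * \<bar>x - x\<bar>) (at x)"
      by (intro tendsto_intros)
    then have "((\<lambda>y. C * (1 + \<bar>y\<bar> ^ m + \<bar>x\<bar> ^ m) * \<bar>y - x\<bar>) \<longlongrightarrow> 0) (at x)" by simp
    then have "((\<lambda>y. f y - f x) \<longlongrightarrow> 0) (at x)"
      by (rule Lim_null_comparison[rotated]) (auto intro!: always_eventually C)
    then show ?thesis unfolding isCont_def by (rule LIM_zero_cancel)
  qed
  then show ?thesis by (simp add: continuous_on_eq_continuous_at)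
qed

text \<open>
  The even power of a sum is expanded so that the linear term, whose expectation vanishes for a
  centred \<open>x\<close>, stays exact. Every other term \<open>x\<^sup>k y\<^sup>N\<^sup>-\<^sup>k\<close> with \<open>k \<ge> 2\<close> is dominated by one of the two
  extreme ones, according to which of \<open>|x|\<close> and \<open>|y|\<close> is larger.
\<close>

lemma binomial_square_bound:
  fixes y x :: real
  shows "(y + x) ^ (2 * m + 2) \<le> y ^ (2 * m + 2) + real (2 * m + 2) * y ^ (2 * m + 1) * x
           + 2 ^ (2 * m + 2) * (y ^ (2 * m) * x\<^sup>2 + x ^ (2 * m + 2))"
proof -
  let ?N = "2 * m + 2" and ?b = "y ^ (2 * m) * x\<^sup>2 + x ^ (2 * m + 2)"
  have ev: "\<bar>z\<bar> ^ (2 * m) = z ^ (2 * m)" "\<bar>z\<bar> ^ (2 * m + 2) = z ^ (2 * m + 2)" for z :: real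
    by (auto simp: power_even_abs)
  have bound: "x ^ k * y ^ (?N - k) \<le> ?b" if k: "k \<in> {2..?N}" for k
  proof (cases "\<bar>x\<bar> \<le> \<bar>y\<bar>")
    case True
    have "\<bar>x\<bar> ^ k = \<bar>x\<bar> ^ 2 * \<bar>x\<bar> ^ (k - 2)"
      using k by (metis atLeastAtMost_iff le_add_diff_inverse power_add)
    then have "\<bar>x\<bar> ^ k * \<bar>y\<bar> ^ (?N - k) = \<bar>x\<bar> ^ 2 * (\<bar>x\<bar> ^ (k - 2) * \<bar>y\<bar> ^ (?N - k))"
      by (simp only: mult.assoc)
    also have "\<dots> \<le> \<bar>x\<bar> ^ 2 * (\<bar>y\<bar> ^ (k - 2) * \<bar>y\<bar> ^ (?N - k))"
      using True by (intro mult_left_mono mult_right_mono power_mono) auto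
    also have "\<bar>y\<bar> ^ (k - 2) * \<bar>y\<bar> ^ (?N - k) = y ^ (2 * m)"
    proof -
      have "k - 2 + (?N - k) = 2 * m" using k by auto
      then show ?thesis by (simp only: power_add[symmetric] ev)
    qed
    also have "\<bar>x\<bar> ^ 2 * y ^ (2 * m) = y ^ (2 * m) * x\<^sup>2" by simp
    also have "\<dots> \<le> ?b" using zero_le_even_power[of ?N x] by simp
    finally show ?thesis
      using abs_ge_self[of "x ^ k * y ^ (?N - k)"] by (simp add: abs_mult power_abs)
  next
    case False
    have "\<bar>x\<bar> ^ k * \<bar>y\<bar> ^ (?N - k) \<le> \<bar>x\<bar> ^ k * \<bar>x\<bar> ^ (?N - k)"
      using False by (intro mult_left_mono power_mono) auto
    also have "\<dots> = x ^ ?N" using k ev[of x] by (simp flip: power_add)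
    also have "\<dots> \<le> ?b" using zero_le_even_power[of "2 * m" y] by simp
    finally show ?thesis
      using abs_ge_self[of "x ^ k * y ^ (?N - k)"] by (simp add: abs_mult power_abs)
  qed
  have b0: "0 \<le> ?b" using zero_le_even_power[of ?N x] zero_le_even_power[of "2 * m" y] by simp
  define N where "N = ?N"
  have N: "2 \<le> N" "N - 1 = 2 * m + 1" by (auto simp: N_def)
  have "(y + x) ^ N = (\<Sum>k\<le>N. of_nat (N choose k) * x ^ k * y ^ (N - k))"
    by (subst add.commute) (rule binomial_ring)
  also have "{..N} = {0, 1} \<union> {2..N}" using N by auto
  also have "(\<Sum>k\<in>{0, 1} \<union> {2..N}. of_nat (N choose k) * x ^ k * y ^ (N - k))
      = y ^ N + real N * y ^ (2 * m + 1) * x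
        + (\<Sum>k\<in>{2..N}. of_nat (N choose k) * x ^ k * y ^ (N - k))"
    using N by (subst sum.union_disjoint) (auto simp: mult_ac)
  also have "(\<Sum>k\<in>{2..N}. of_nat (N choose k) * x ^ k * y ^ (N - k))
      \<le> (\<Sum>k\<in>{2..N}. real (N choose k) * ?b)"
    using bound unfolding N_def by (intro sum_mono) (simp only: mult.assoc, intro mult_left_mono, auto)
  also have "\<dots> \<le> (\<Sum>k\<le>N. real (N choose k) * ?b)"
    using b0 by (intro sum_mono2) auto
  also have "\<dots> = real (\<Sum>k\<le>N. N choose k) * ?b"
    by (simp only: sum_distrib_right of_nat_sum)
  also have "\<dots> = 2 ^ N * ?b"
    by (simp add: choose_row_sum)
  finally show ?thesis by (simp only: N_def)
qed

text \<open>
  A common Lipschitz constant reduces closeness on a compact set to closeness on a finite net.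
\<close>

lemma pointwise_limit_of_Lipschitz_uniform:
  fixes F :: "nat \<Rightarrow> real \<Rightarrow> real"
  assumes lip: "\<And>n x y. \<bar>F n x - F n y\<bar> \<le> L * \<bar>x - y\<bar>"
    and lim: "\<And>x. (\<lambda>n. F n x) \<longlonglongrightarrow> g x"
    and S: "compact S" and \<eta>: "0 < \<eta>"
  shows "\<forall>\<^sub>F n in sequentially. \<forall>x\<in>S. \<bar>F n x - g x\<bar> \<le> \<eta>"
proof -
  have glip: "\<bar>g x - g y\<bar> \<le> L * \<bar>x - y\<bar>" for x y
    by (rule LIMSEQ_le_const2[OF tendsto_rabs[OF tendsto_diff[OF lim lim]]]) (use lip in blast)
  define \<delta> where "\<delta> = \<eta> / (3 * (\<bar>L\<bar> + 1))"
  have \<delta>: "0 < \<delta>" using \<eta> by (simp add: \<delta>_def)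
  have L\<delta>: "L * r \<le> \<eta> / 3" if "0 \<le> r" "r \<le> \<delta>" for r
  proof -
    have "L * r \<le> (\<bar>L\<bar> + 1) * \<delta>" using that by (intro mult_mono) auto
    also have "\<dots> = \<eta> / 3" by (simp add: \<delta>_def field_simps add_eq_0_iff)
    finally show "L * r \<le> \<eta> / 3" .
  qed
  have "S \<subseteq> (\<Union>c\<in>S. ball c \<delta>)" using \<delta> by auto
  then obtain T where T: "finite T" "S \<subseteq> (\<Union>c\<in>T. ball c \<delta>)"
    using compactE_image[OF S, of S "\<lambda>c. ball c \<delta>"] by (metis open_ball)
  have "\<forall>\<^sub>F n in sequentially. \<forall>c\<in>T. \<bar>F n c - g c\<bar> < \<eta> / 3"
  proof (intro eventually_ball_finite T(1) ballI)
    fix c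
    show "\<forall>\<^sub>F n in sequentially. \<bar>F n c - g c\<bar> < \<eta> / 3"
      using tendstoD[OF lim[of c], of "\<eta> / 3"] \<eta> by (simp add: dist_real_def)
  qed
  then show ?thesis
  proof eventually_elim
    case (elim n)
    show ?case
    proof
      fix x assume "x \<in> S"
      then obtain c where c: "c \<in> T" "\<bar>x - c\<bar> \<le> \<delta>"
        using T(2) by (fastforce simp: dist_real_def)
      have "\<bar>F n x - F n c\<bar> \<le> \<eta> / 3" "\<bar>g x - g c\<bar> \<le> \<eta> / 3"
        using lip[of n x c] glip[of x c] L\<delta>[of "\<bar>x - c\<bar>"] c(2) by auto
      moreover have "\<bar>F n c - g c\<bar> < \<eta> / 3" using elim c(1) by blast
      ultimately show "\<bar>F n x - g x\<bar> \<le> \<eta>" by linarith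
    qed
  qed
qed

text \<open>
  A variant of the Arzela-Ascoli theorem for functions that may be discontinuous individually, as
  long as the oscillations vanish along the sequence. A diagonal subsequence converges on a
  countable dense subset, and equicontinuity carries the Cauchy property to the other points.
\<close>

lemma asymptotically_equicontinuous_subsequence:
  fixes F :: "nat \<Rightarrow> 'a::euclidean_space \<Rightarrow> real"
  assumes bound: "\<And>n z. z \<in> S \<Longrightarrow> \<bar>F n z\<bar> \<le> B"
    and equi: "\<And>z \<epsilon>. z \<in> S \<Longrightarrow> 0 < \<epsilon> \<Longrightarrow>
      \<exists>d>0. \<forall>\<^sub>F n in sequentially. \<forall>w\<in>S. dist w z < d \<longrightarrow> \<bar>F n w - F n z\<bar> < \<epsilon>"
  obtains k g where "strict_mono (k :: nat \<Rightarrow> nat)"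
    "\<And>z. z \<in> S \<Longrightarrow> (\<lambda>n. F (k n) z) \<longlonglongrightarrow> g z"
proof -
  obtain R where R: "countable R" "R \<subseteq> S" "S \<subseteq> closure R"
    using separable by metis
  obtain k where k: "strict_mono k" "\<And>z. z \<in> R \<Longrightarrow> \<exists>l. (\<lambda>n. F (k n) z) \<longlonglongrightarrow> l"
    using function_convergent_subsequence[of R F B] R bound by (auto simp: subset_iff)
  have "\<exists>l. (\<lambda>n. F (k n) z) \<longlonglongrightarrow> l" if z: "z \<in> S" for z
  proof -
    have "Cauchy (\<lambda>n. F (k n) z)"
    proof (rule metric_CauchyI)
      fix e :: real assume e: "0 < e"
      then obtain d where d: "0 < d" "\<forall>\<^sub>F n in sequentially. \<forall>w\<in>S. dist w z < d \<longrightarrow> \<bar>F n w - F n z\<bar> < e / 3"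
        using equi[OF z, of "e / 3"] by auto
      obtain w where w: "w \<in> R" "dist w z < d"
        using R(3) z d(1) by (meson closure_approachable subset_iff)
      have "Cauchy (\<lambda>n. F (k n) w)" using k(2)[OF w(1)] convergent_eq_Cauchy by blast
      then obtain M1 where M1: "\<And>m n. m \<ge> M1 \<Longrightarrow> n \<ge> M1 \<Longrightarrow> \<bar>F (k m) w - F (k n) w\<bar> < e / 3"
        using e by (metis metric_CauchyD dist_real_def zero_less_divide_iff zero_less_numeral)
      obtain M2 where M2: "\<And>n. n \<ge> M2 \<Longrightarrow> \<bar>F n w - F n z\<bar> < e / 3"
        using d(2) w R(2) unfolding eventually_sequentially by (meson subset_iff)
      show "\<exists>M. \<forall>m\<ge>M. \<forall>n\<ge>M. dist (F (k m) z) (F (k n) z) < e"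
      proof (intro exI[of _ "max M1 M2"] allI impI)
        fix m n assume mn: "max M1 M2 \<le> m" "max M1 M2 \<le> n"
        have "M2 \<le> k m" "M2 \<le> k n"
          using mn seq_suble[OF k(1), of m] seq_suble[OF k(1), of n] by auto
        then have "\<bar>F (k m) w - F (k m) z\<bar> < e / 3" "\<bar>F (k n) w - F (k n) z\<bar> < e / 3"
          using M2 by auto
        moreover have "\<bar>F (k m) w - F (k n) w\<bar> < e / 3" using M1 mn by auto
        ultimately show "dist (F (k m) z) (F (k n) z) < e" unfolding dist_real_def by linarith
      qed
    qed
    then show ?thesis by (simp add: Cauchy_convergent_iff convergent_def)
  qed
  then show thesis using that[OF k(1), of "\<lambda>z. SOME l. (\<lambda>n. F (k n) z) \<longlonglongrightarrow> l"] by (metis someI_ex)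
qed

lemma LIMSEQ_if_subsubsequences:
  fixes a :: "nat \<Rightarrow> real"
  assumes "\<And>r. strict_mono r \<Longrightarrow> \<exists>q. strict_mono (q :: nat \<Rightarrow> nat) \<and> (\<lambda>n. a (r (q n))) \<longlonglongrightarrow> l"
  shows "a \<longlonglongrightarrow> l"
proof (rule ccontr)
  assume "\<not> a \<longlonglongrightarrow> l"
  then obtain e where e: "0 < e" "\<not> (\<forall>\<^sub>F n in sequentially. dist (a n) l < e)"
    unfolding tendsto_iff by blast
  then have "infinite {n. \<not> dist (a n) l < e}"
    by (simp add: not_eventually frequently_cofinite flip: cofinite_eq_sequentially)
  then obtain r :: "nat \<Rightarrow> nat" where r: "strict_mono r" "\<And>n. \<not> dist (a (r n)) l < e"
    using infinite_enumerate by blast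
  obtain q where "(\<lambda>n. a (r (q n))) \<longlonglongrightarrow> l" using assms[OF r(1)] by blast
  then have "\<forall>\<^sub>F n in sequentially. dist (a (r (q n))) l < e" using e(1) by (simp add: tendsto_iff)
  with r(2) show False by simp
qed

text \<open>
  On a long interval \<open>[-R, R]\<close> the approximation is a Weierstrass polynomial; outside it is continued
  by the values at the end points. The error outside is of order \<open>|x|\<^sup>q\<close>, which is a small multiple
  of \<open>|x|\<^sup>2\<^sup>q\<close> once \<open>R\<close> is large compared with \<open>1 / \<epsilon>\<close>.
\<close>

lemma bounded_Lipschitz_approximation:
  fixes \<phi> :: "real \<Rightarrow> real"
  assumes cont: "continuous_on UNIV \<phi>"
    and growth: "\<And>x. \<bar>\<phi> x\<bar> \<le> C * (1 + \<bar>x\<bar> powr p)" and C: "0 < C" and q: "p \<le> real q" "1 \<le> q"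
    and \<epsilon>: "0 < \<epsilon>"
  shows "\<exists>f L B. bounded_Lipschitz L B f \<and> (\<forall>x. \<bar>\<phi> x - f x\<bar> \<le> \<epsilon> * (1 + x ^ (2 * q)))"
proof -
  define R where "R = max 1 (4 * C / \<epsilon>)"
  have R: "1 \<le> R" "4 * C \<le> \<epsilon> * R"
    using \<epsilon> by (auto simp: R_def max_def field_simps)
  obtain g where g: "polynomial_function g" "\<And>x. x \<in> {-R..R} \<Longrightarrow> \<bar>\<phi> x - g x\<bar> < \<epsilon>"
    using Stone_Weierstrass_polynomial_function[of "{-R..R}" \<phi> \<epsilon>] cont \<epsilon>
    by (metis compact_Icc continuous_on_subset real_norm_def subset_UNIV)
  obtain g' where g': "polynomial_function g'" "\<And>x. (g has_vector_derivative g' x) (at x)"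
    using has_vector_derivative_polynomial_function[OF g(1)] by metis
  obtain L where L: "\<And>x. x \<in> {-R..R} \<Longrightarrow> \<bar>g' x\<bar> \<le> L"
    using compact_continuous_image[OF continuous_on_polymonial_function[OF g'(1)] compact_Icc, of "-R" R]
    by (metis bounded_iff compact_imp_bounded imageI real_norm_def)
  obtain B where B: "\<And>x. x \<in> {-R..R} \<Longrightarrow> \<bar>g x\<bar> \<le> B"
    using compact_continuous_image[OF continuous_on_polymonial_function[OF g(1)] compact_Icc, of "-R" R]
    by (metis bounded_iff compact_imp_bounded imageI real_norm_def)
  define c where "c x = max (-R) (min R x)" for x
  have c: "c x \<in> {-R..R}" "\<bar>c x - c y\<bar> \<le> \<bar>x - y\<bar>" for x y
    using R(1) by (auto simp: c_def max_def min_def)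
  have glip: "\<bar>g x - g y\<bar> \<le> L * \<bar>x - y\<bar>" if "x \<in> {-R..R}" "y \<in> {-R..R}" for x y
    using field_differentiable_bound[of "{-R..R}" g g' L x y] g'(2) L that
    by (simp add: has_real_derivative_iff_has_vector_derivative has_vector_derivative_at_within)
  have "0 \<le> L" using L[of 0] R by auto
  show ?thesis
    unfolding bounded_Lipschitz_def
  proof (intro exI conjI allI)
    show "\<bar>g (c x) - g (c y)\<bar> \<le> L * \<bar>x - y\<bar>" for x y
      using glip[OF c(1) c(1), of x y] mult_left_mono[OF c(2) \<open>0 \<le> L\<close>, of x y] by linarith
    show "\<bar>g (c x)\<bar> \<le> B" for x using B c by blast
    show "\<bar>\<phi> x - g (c x)\<bar> \<le> \<epsilon> * (1 + x ^ (2 * q))" for x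
    proof (cases "\<bar>x\<bar> \<le> R")
      case True
      then have "\<bar>\<phi> x - g (c x)\<bar> < \<epsilon>" using g(2)[of x] by (simp add: c_def abs_le_iff)
      moreover have "0 \<le> \<epsilon> * x ^ (2 * q)" using \<epsilon> zero_le_even_power[of "2 * q" x] by simp
      ultimately show ?thesis by (simp add: algebra_simps)
    next
      case False
      have pow: "\<bar>z\<bar> powr p \<le> \<bar>x\<bar> ^ q" if "\<bar>z\<bar> \<le> \<bar>x\<bar>" "\<bar>z\<bar> \<ge> 1" for z
      proof -
        have "\<bar>z\<bar> powr p \<le> \<bar>z\<bar> powr real q" using that q by (intro powr_mono) auto
        also have "\<dots> = \<bar>z\<bar> ^ q" using that by (intro powr_realpow) auto
        also have "\<dots> \<le> \<bar>x\<bar> ^ q" using that by (intro power_mono) auto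
        finally show ?thesis .
      qed
      have one: "1 \<le> \<bar>x\<bar> ^ q" using False R by (intro one_le_power) auto
      have growth': "\<bar>\<phi> z\<bar> \<le> 2 * C * \<bar>x\<bar> ^ q" if "\<bar>z\<bar> \<le> \<bar>x\<bar>" "\<bar>z\<bar> \<ge> 1" for z
      proof -
        have "C * (1 + \<bar>z\<bar> powr p) \<le> C * (\<bar>x\<bar> ^ q + \<bar>x\<bar> ^ q)"
          using pow[OF that] one C by (intro mult_left_mono add_mono) auto
        with growth[of z] show ?thesis by simp
      qed
      have cx: "\<bar>c x\<bar> = R" using False R by (auto simp: c_def max_def min_def)
      have bound: "\<bar>\<phi> x - g (c x)\<bar> \<le> 2 * C * \<bar>x\<bar> ^ q + 2 * C * \<bar>x\<bar> ^ q + \<epsilon>"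
        using growth'[of x] growth'[of "c x"] g(2)[OF c(1), of x] cx False R by linarith
      have "4 * C * \<bar>x\<bar> ^ q \<le> \<epsilon> * \<bar>x\<bar> ^ q * \<bar>x\<bar> ^ q"
      proof -
        have "R \<le> \<bar>x\<bar> ^ q" using self_le_power[of "\<bar>x\<bar>" q] False R q by auto
        then have "\<epsilon> * R \<le> \<epsilon> * \<bar>x\<bar> ^ q" using \<epsilon> by simp
        with R have "4 * C \<le> \<epsilon> * \<bar>x\<bar> ^ q" by linarith
        then show ?thesis by (intro mult_right_mono) auto
      qed
      moreover have "\<bar>x\<bar> ^ q * \<bar>x\<bar> ^ q = x ^ (2 * q)"
        by (metis dvd_triv_left mult_2 power_add power_even_abs)
      ultimately have "2 * C * \<bar>x\<bar> ^ q + 2 * C * \<bar>x\<bar> ^ q + \<epsilon> \<le> \<epsilon> * (1 + x ^ (2 * q))"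
        by (simp only: mult.assoc) (simp add: algebra_simps)
      with bound show ?thesis by linarith
    qed
  qed
qed

section \<open>Upper expectations\<close>

context sublinear_expectation_space begin

abbreviation E :: "('a \<Rightarrow> real) \<Rightarrow> real" where
  "E \<equiv> upper_expectation \<P>"

text \<open>
  The random variables dominated by an element of \<open>H\<close>: the upper expectation is finite on them and
  has all properties of a sublinear expectation, without requiring membership in \<open>H\<close>, which is
  closed only under locally Lipschitz operations.
\<close>

definition Dom :: "('a \<Rightarrow> real) set" where
  "Dom = {Z \<in> borel_measurable M. \<exists>Y\<in>H. \<forall>\<omega>\<in>space M. \<bar>Z \<omega>\<bar> \<le> Y \<omega>}"

lemma DomI:
  "Z \<in> borel_measurable M \<Longrightarrow> Y \<in> H \<Longrightarrow> (\<And>\<omega>. \<omega> \<in> space M \<Longrightarrow> \<bar>Z \<omega>\<bar> \<le> Y \<omega>) \<Longrightarrow> Z \<in> Dom"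
  by (auto simp: Dom_def)

lemma H_Dom: "Z \<in> H \<Longrightarrow> Z \<in> Dom"
  by (rule DomI[OF random_variable abs]) auto

lemma Dom_const: "(\<lambda>_. c) \<in> Dom"
  by (rule H_Dom[OF const])

lemma Dom_add:
  assumes "Z \<in> Dom" "W \<in> Dom" shows "(\<lambda>\<omega>. Z \<omega> + W \<omega>) \<in> Dom"
proof -
  obtain Y Y' where "Y \<in> H" "Y' \<in> H" and le: "\<And>\<omega>. \<omega> \<in> space M \<Longrightarrow> \<bar>Z \<omega>\<bar> \<le> Y \<omega>"
    "\<And>\<omega>. \<omega> \<in> space M \<Longrightarrow> \<bar>W \<omega>\<bar> \<le> Y' \<omega>"
    using assms by (auto simp: Dom_def)
  then show ?thesis using assms
    by (intro DomI[OF _ add[of Y Y']]) (auto simp: Dom_def intro: order_trans[OF abs_triangle_ineq add_mono])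
qed

lemma Dom_scale:
  assumes "Z \<in> Dom" shows "(\<lambda>\<omega>. c * Z \<omega>) \<in> Dom"
proof -
  obtain Y where "Y \<in> H" "\<And>\<omega>. \<omega> \<in> space M \<Longrightarrow> \<bar>Z \<omega>\<bar> \<le> Y \<omega>"
    using assms by (auto simp: Dom_def)
  then show ?thesis using assms
    by (intro DomI[OF _ scale[of Y "\<bar>c\<bar>"]]) (auto simp: Dom_def abs_mult mult_left_mono)
qed

lemmas Dom_intros = H_Dom Dom_const Dom_add Dom_scale

lemma Dom_integrable: "Z \<in> Dom \<Longrightarrow> P \<in> \<P> \<Longrightarrow> integrable P Z"
  unfolding Dom_def using dominated(1) by blast

lemma integral_le_E:
  assumes "Z \<in> Dom" "P \<in> \<P>" shows "integral\<^sup>L P Z \<le> E Z"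
proof -
  have "bdd_above ((\<lambda>P. integral\<^sup>L P Z) ` \<P>)"
  proof -
    obtain Y where Y: "Y \<in> H" "\<And>\<omega>. \<omega> \<in> space M \<Longrightarrow> \<bar>Z \<omega>\<bar> \<le> Y \<omega>"
      using assms(1) by (auto simp: Dom_def)
    have "Z \<in> borel_measurable M" using assms(1) by (simp add: Dom_def)
    from dominated(2)[OF this Y] show ?thesis .
  qed
  then show ?thesis unfolding upper_expectation_def by (intro cSUP_upper assms(2))
qed

lemma E_leI: "(\<And>P. P \<in> \<P> \<Longrightarrow> integral\<^sup>L P Z \<le> c) \<Longrightarrow> E Z \<le> c"
  unfolding upper_expectation_def using nonempty by (intro cSUP_least)

lemma space_eq: "P \<in> \<P> \<Longrightarrow> space P = space M"
  using sets_eq sets_eq_imp_space_eq by blast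

lemma E_mono:
  assumes "Z \<in> Dom" "W \<in> Dom" "\<And>\<omega>. \<omega> \<in> space M \<Longrightarrow> Z \<omega> \<le> W \<omega>"
  shows "E Z \<le> E W"
proof (rule E_leI)
  fix P assume P: "P \<in> \<P>"
  have "integral\<^sup>L P Z \<le> integral\<^sup>L P W"
    using assms(3) space_eq[OF P] by (intro integral_mono Dom_integrable assms P) auto
  with integral_le_E[OF assms(2) P] show "integral\<^sup>L P Z \<le> E W" by simp
qed

lemma E_const: "E (\<lambda>_. c) = c"
proof -
  have "integral\<^sup>L P (\<lambda>_. c) = c" if "P \<in> \<P>" for P
    using prob_space.prob_space[OF prob_space[OF that]] by simp
  then have "E (\<lambda>_. c) = (SUP P\<in>\<P>. c)"
    unfolding upper_expectation_def by (intro SUP_cong refl) auto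
  with nonempty show ?thesis by simp
qed

lemma E_add_le:
  assumes "Z \<in> Dom" "W \<in> Dom" shows "E (\<lambda>\<omega>. Z \<omega> + W \<omega>) \<le> E Z + E W"
proof (rule E_leI)
  fix P assume P: "P \<in> \<P>"
  show "integral\<^sup>L P (\<lambda>\<omega>. Z \<omega> + W \<omega>) \<le> E Z + E W"
    using integral_le_E[OF _ P, of Z] integral_le_E[OF _ P, of W] assms
    by (simp add: Dom_integrable P)
qed

lemma E_scale_le:
  assumes "Z \<in> Dom" "0 \<le> c" shows "E (\<lambda>\<omega>. c * Z \<omega>) \<le> c * E Z"
  using integral_le_E[OF assms(1)] assms(2) by (intro E_leI) (simp add: mult_left_mono)

lemma E_scale:
  assumes "Z \<in> Dom" "0 \<le> c" shows "E (\<lambda>\<omega>. c * Z \<omega>) = c * E Z"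
proof (cases "c = 0")
  case True
  then show ?thesis by (simp add: E_const)
next
  case False
  have "(\<lambda>\<omega>. inverse c * (c * Z \<omega>)) = Z"
    using False by (simp flip: mult.assoc)
  then have "E Z \<le> inverse c * E (\<lambda>\<omega>. c * Z \<omega>)"
    using E_scale_le[OF Dom_scale[OF assms(1), of c], of "inverse c"] False assms(2) by simp
  then have "c * E Z \<le> E (\<lambda>\<omega>. c * Z \<omega>)"
    using False assms(2) by (simp add: field_simps)
  with E_scale_le[OF assms] show ?thesis by simp
qed

lemma E_add_const:
  assumes "Z \<in> Dom" shows "E (\<lambda>\<omega>. Z \<omega> + c) = E Z + c"
proof (rule antisym)
  show "E (\<lambda>\<omega>. Z \<omega> + c) \<le> E Z + c"
    using E_add_le[OF assms Dom_const[of c]] by (simp add: E_const)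
  show "E Z + c \<le> E (\<lambda>\<omega>. Z \<omega> + c)"
    using E_add_le[OF Dom_add[OF assms Dom_const[of c]] Dom_const[of "- c"]] by (simp add: E_const)
qed

lemma E_diff_le:
  assumes "Z \<in> Dom" "W \<in> Dom" "U \<in> Dom" "\<And>\<omega>. \<omega> \<in> space M \<Longrightarrow> \<bar>Z \<omega> - W \<omega>\<bar> \<le> U \<omega>"
  shows "\<bar>E Z - E W\<bar> \<le> E U"
proof -
  have "E Z \<le> E (\<lambda>\<omega>. W \<omega> + U \<omega>)" "E W \<le> E (\<lambda>\<omega>. Z \<omega> + U \<omega>)"
    using assms(4) by (intro E_mono Dom_intros assms; fastforce simp: abs_le_iff)+
  with E_add_le[OF assms(2,3)] E_add_le[OF assms(1,3)] show ?thesis by linarith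
qed

text \<open>
  A variable without mean uncertainty is additive under a sublinear expectation: both it and its
  negative contribute nothing, so subadditivity gives the two inequalities.
\<close>

lemma E_mean_certain:
  assumes "Y \<in> Dom" "E Y = 0" "E (\<lambda>\<omega>. - Y \<omega>) = 0" "Z \<in> Dom"
  shows "E (\<lambda>\<omega>. b * Y \<omega> + Z \<omega>) = E Z"
proof -
  have zero: "E (\<lambda>\<omega>. b * Y \<omega>) = 0" for b
  proof (cases "0 \<le> b")
    case True
    then show ?thesis using E_scale assms by simp
  next
    case False
    then show ?thesis
      using E_scale[OF Dom_scale[OF assms(1), of "-1"], of "- b"] assms(3) by simp
  qed
  have "E (\<lambda>\<omega>. b * Y \<omega> + Z \<omega>) \<le> E Z"
    using E_add_le[OF Dom_scale[OF assms(1), of b] assms(4)] zero by simp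
  moreover have "E (\<lambda>\<omega>. - b * Y \<omega> + (b * Y \<omega> + Z \<omega>)) \<le> E (\<lambda>\<omega>. b * Y \<omega> + Z \<omega>)"
    using E_add_le[OF Dom_scale[OF assms(1)] Dom_add[OF Dom_scale[OF assms(1)] assms(4)], of "- b" b]
      zero[of "- b"] by simp
  ultimately show ?thesis by simp
qed

lemma C_lLip_in_H:
  assumes "Z \<in> H" "C_lLip f" shows "(\<lambda>\<omega>. f (Z \<omega>)) \<in> H"
proof -
  have "C_lLip_n 1 (\<lambda>x. f (x 1))"
    using assms(2) unfolding C_lLip_def C_lLip_n_def by simp metis
  from C_lLip_closed[of 1 "\<lambda>_. Z", OF assms(1) this] show ?thesis by simp
qed

lemma power_in_H: "Z \<in> H \<Longrightarrow> (\<lambda>\<omega>. Z \<omega> ^ n) \<in> H"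
  using C_lLip_in_H[OF _ C_lLip_power] by simp

lemma affine_in_H: "Z \<in> H \<Longrightarrow> (\<lambda>\<omega>. a + b * Z \<omega>) \<in> H"
  by (intro add const scale)

lemma sum_in_H: "(\<And>i. i \<in> I \<Longrightarrow> Z i \<in> H) \<Longrightarrow> (\<lambda>\<omega>. \<Sum>i\<in>I. Z i \<omega>) \<in> H"
  by (induction I rule: infinite_finite_induct) (auto intro: const add)

end

section \<open>Viscosity inequalities from quartic bounds\<close>

lemma second_order_upper_bound:
  fixes f f' f'' :: "real \<Rightarrow> real"
  assumes f: "\<And>x. (f has_real_derivative f' x) (at x)"
    and f': "\<And>x. (f' has_real_derivative f'' x) (at x)"
    and le: "\<And>z. \<bar>z - x\<bar> < r \<Longrightarrow> f'' z \<le> c" and y: "\<bar>y\<bar> < r"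
  shows "f (x + y) \<le> f x + f' x * y + c / 2 * y\<^sup>2"
proof (cases "y = 0")
  case False
  define F where "F k = (if k = 0 then f else if k = Suc 0 then f' else f'')" for k :: nat
  have "\<exists>t. (if x + y < x then x + y < t \<and> t < x else x < t \<and> t < x + y) \<and>
      f (x + y) = (\<Sum>k<2. F k x / fact k * (x + y - x) ^ k) + F 2 t / fact 2 * (x + y - x) ^ 2"
    using False f f' by (intro Taylor[where a = "min x (x + y)" and b = "max x (x + y)"])
      (auto simp: F_def less_2_cases_iff)
  then obtain t where t: "if x + y < x then x + y < t \<and> t < x else x < t \<and> t < x + y"
    "f (x + y) = f x + f' x * y + f'' t / 2 * y\<^sup>2"
    by (auto simp: F_def numeral_2_eq_2)
  have "\<bar>t - x\<bar> < r" using t(1) y by (auto split: if_splits)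
  then have "f'' t / 2 * y\<^sup>2 \<le> c / 2 * y\<^sup>2"
    using le by (intro mult_right_mono) auto
  with t(2) show ?thesis by simp
qed auto

text \<open>
  The hypothesis \<open>step\<close> says that \<open>v\<close> is advanced in time by a monotone evolution that acts on
  quadratic polynomials with generator \<open>G\<close> and moves quartic terms by \<open>O(\<delta>\<^sup>2)\<close> only. If \<open>\<psi>\<close> touches
  \<open>v\<close> from above at \<open>(t, x)\<close>, Taylor's formula, applied backwards in time and in space, bounds \<open>v\<close>
  near \<open>(t, x)\<close> by a quadratic polynomial whose coefficients are those of \<open>\<psi>\<close> up to \<open>\<epsilon>\<close>. Since \<open>v\<close> is
  bounded, adding \<open>K y\<^sup>4\<close> makes this bound valid for all \<open>y\<close>. Evolving for time \<open>\<delta>\<close>, dividing by \<open>\<delta>\<close>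
  and letting \<open>\<delta> \<rightarrow> 0\<close> and then \<open>\<epsilon> \<rightarrow> 0\<close> gives the viscosity inequality.
\<close>

lemma viscosity_subsolution_of_quartic_bound:
  fixes v :: "real \<Rightarrow> real \<Rightarrow> real"
  assumes G: "\<And>c. isCont G c"
    and bound: "\<And>t x. 0 \<le> t \<Longrightarrow> \<bar>v t x\<bar> \<le> B"
    and step: "\<And>t \<delta> x A b c K. 0 < \<delta> \<Longrightarrow> \<delta> \<le> t \<Longrightarrow> 0 \<le> K \<Longrightarrow>
      (\<And>y. v (t - \<delta>) (x + y) \<le> A + b * y + c / 2 * y\<^sup>2 + K * y ^ 4) \<Longrightarrow>
      v t x \<le> A + \<delta> * G c + \<delta>\<^sup>2 * (K * D)"
  shows "viscosity_subsolution G (\<lambda>(t, x). v t x)"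
  unfolding viscosity_subsolution_def
proof (intro allI impI, elim conjE)
  fix t x :: real and \<psi> \<psi>t \<psi>x \<psi>xx :: "real \<times> real \<Rightarrow> real"
  assume t: "0 < t" and \<psi>: "C12_derivs \<psi> \<psi>t \<psi>x \<psi>xx"
    and max: "\<forall>\<^sub>F z in nhds (t, x). (case z of (t, x) \<Rightarrow> v t x) - \<psi> z
                \<le> (case (t, x) of (t, x) \<Rightarrow> v t x) - \<psi> (t, x)"
  define a b c where "a = \<psi>t (t, x)" and "b = \<psi>x (t, x)" and "c = \<psi>xx (t, x)"
  have d: "((\<lambda>s. \<psi> (s, y)) has_real_derivative \<psi>t (s, y)) (at s)"
    "((\<lambda>y. \<psi> (s, y)) has_real_derivative \<psi>x (s, y)) (at y)"
    "((\<lambda>y. \<psi>x (s, y)) has_real_derivative \<psi>xx (s, y)) (at y)" if "0 < s" for s y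
    using \<psi> that unfolding C12_derivs_def by blast+
  have cont: "isCont \<psi>t (t, x)" "isCont \<psi>xx (t, x)"
  proof -
    have "open ({0::real<..} \<times> (UNIV :: real set))" by (intro open_Times) auto
    then show "isCont \<psi>t (t, x)" "isCont \<psi>xx (t, x)"
      using \<psi> t unfolding C12_derivs_def by (auto simp: continuous_on_eq_continuous_at)
  qed
  have perturbed: "a - \<epsilon> \<le> G (c + \<epsilon>)" if \<epsilon>: "0 < \<epsilon>" for \<epsilon>
  proof -
    have "\<forall>\<^sub>F z in nhds (t, x). \<bar>\<psi>t z - a\<bar> < \<epsilon>" "\<forall>\<^sub>F z in nhds (t, x). \<bar>\<psi>xx z - c\<bar> < \<epsilon>"
      using cont[unfolded isCont_def tendsto_at_iff_tendsto_nhds, THEN tendstoD, OF \<epsilon>]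
      unfolding a_def c_def by (auto simp: dist_real_def)
    with max have "\<forall>\<^sub>F z in nhds (t, x). v (fst z) (snd z) - \<psi> z \<le> v t x - \<psi> (t, x)
        \<and> \<bar>\<psi>t z - a\<bar> < \<epsilon> \<and> \<bar>\<psi>xx z - c\<bar> < \<epsilon>"
      by eventually_elim (auto simp: case_prod_beta)
    then obtain r where r: "0 < r" "\<And>z. dist z (t, x) < r \<Longrightarrow> v (fst z) (snd z) - \<psi> z \<le> v t x - \<psi> (t, x)
        \<and> \<bar>\<psi>t z - a\<bar> < \<epsilon> \<and> \<bar>\<psi>xx z - c\<bar> < \<epsilon>"
      unfolding eventually_nhds_metric by blast
    define \<rho> where "\<rho> = min (r / 2) (t / 2)"
    have \<rho>: "0 < \<rho>" "\<rho> < t" "\<rho> \<le> r / 2" using r t by (auto simp: \<rho>_def)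
    have near: "v s y - \<psi> (s, y) \<le> v t x - \<psi> (t, x)" "\<bar>\<psi>t (s, y) - a\<bar> < \<epsilon>" "\<bar>\<psi>xx (s, y) - c\<bar> < \<epsilon>"
      if "\<bar>s - t\<bar> < \<rho>" "\<bar>y - x\<bar> < \<rho>" for s y
    proof -
      have "dist (s, y) (t, x) \<le> \<bar>s - t\<bar> + \<bar>y - x\<bar>"
        by (simp add: dist_Pair_Pair dist_real_def) (rule order_trans[OF sqrt_sum_squares_le_sum_abs], simp)
      with that \<rho> have "dist (s, y) (t, x) < r" by linarith
      from r(2)[OF this] show "v s y - \<psi> (s, y) \<le> v t x - \<psi> (t, x)"
        "\<bar>\<psi>t (s, y) - a\<bar> < \<epsilon>" "\<bar>\<psi>xx (s, y) - c\<bar> < \<epsilon>" by auto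
    qed
    \<comment> \<open>the three summands absorb, for \<open>|y| \<ge> \<rho>\<close>, the constant, linear and quadratic terms\<close>
    define K where "K = (2 * B + \<bar>a - \<epsilon>\<bar> * \<rho>) / \<rho> ^ 4 + \<bar>b\<bar> / \<rho> ^ 3 + \<bar>c + \<epsilon>\<bar> / 2 / \<rho> ^ 2"
    have B: "0 \<le> B" using bound[of 0 0] by simp
    have K: "0 \<le> K" using \<rho> B unfolding K_def by (intro add_nonneg_nonneg divide_nonneg_nonneg) auto
    have quartic: "v (t - \<delta>) (x + y) \<le> (v t x - (a - \<epsilon>) * \<delta>) + b * y + (c + \<epsilon>) / 2 * y\<^sup>2 + K * y ^ 4"
      if \<delta>: "0 < \<delta>" "\<delta> < \<rho>" for \<delta> y
    proof (cases "\<bar>y\<bar> < \<rho>")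
      case True
      obtain s where s: "t - \<delta> < s" "s < t" "\<psi> (t, x + y) - \<psi> (t - \<delta>, x + y) = (t - (t - \<delta>)) * \<psi>t (s, x + y)"
        using MVT2[of "t - \<delta>" t "\<lambda>s. \<psi> (s, x + y)" "\<lambda>s. \<psi>t (s, x + y)"] d(1) \<delta> \<rho> by auto
      have "\<bar>\<psi>t (s, x + y) - a\<bar> < \<epsilon>" using near(2)[of s "x + y"] s \<delta> True by auto
      then have "\<delta> * (a - \<epsilon>) \<le> \<delta> * \<psi>t (s, x + y)" using \<delta> by (intro mult_left_mono) auto
      with s(3) have 1: "\<psi> (t - \<delta>, x + y) \<le> \<psi> (t, x + y) - (a - \<epsilon>) * \<delta>"
        by (simp add: algebra_simps)
      have "\<psi>xx (t, z) \<le> c + \<epsilon>" if "\<bar>z - x\<bar> < \<rho>" for z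
        using near(3)[of t z] that \<rho> by auto
      then have 2: "\<psi> (t, x + y) \<le> \<psi> (t, x) + b * y + (c + \<epsilon>) / 2 * y\<^sup>2"
        unfolding b_def using second_order_upper_bound[OF d(2)[OF t] d(3)[OF t] _ True] by blast
      have "v (t - \<delta>) (x + y) - \<psi> (t - \<delta>, x + y) \<le> v t x - \<psi> (t, x)"
        using near(1)[of "t - \<delta>" "x + y"] \<delta> True by auto
      moreover have "0 \<le> K * y ^ 4" using K zero_le_even_power[of 4 y] by simp
      ultimately show ?thesis using 1 2 by linarith
    next
      case False
      have pw: "\<rho> ^ j * \<bar>y\<bar> ^ (4 - j) \<le> y ^ 4" if "j \<le> 4" for j
      proof -
        have "\<rho> ^ j * \<bar>y\<bar> ^ (4 - j) \<le> \<bar>y\<bar> ^ j * \<bar>y\<bar> ^ (4 - j)"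
          using \<rho> False by (intro mult_right_mono power_mono) auto
        also have "\<dots> = y ^ 4" using that power_even_abs[of 4 y] by (simp flip: power_add)
        finally show ?thesis .
      qed
      have "2 * B + \<bar>a - \<epsilon>\<bar> * \<rho> \<le> (2 * B + \<bar>a - \<epsilon>\<bar> * \<rho>) / \<rho> ^ 4 * y ^ 4"
        using mult_left_mono[OF pw[of 4], of "(2 * B + \<bar>a - \<epsilon>\<bar> * \<rho>) / \<rho> ^ 4"] \<rho> B by simp
      moreover have "\<bar>b\<bar> * \<bar>y\<bar> \<le> \<bar>b\<bar> / \<rho> ^ 3 * y ^ 4"
        using mult_left_mono[OF pw[of 3], of "\<bar>b\<bar> / \<rho> ^ 3"] \<rho> by simp
      moreover have "\<bar>c + \<epsilon>\<bar> / 2 * y\<^sup>2 \<le> \<bar>c + \<epsilon>\<bar> / 2 / \<rho> ^ 2 * y ^ 4"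
        using mult_left_mono[OF pw[of 2], of "\<bar>c + \<epsilon>\<bar> / 2 / \<rho> ^ 2"] \<rho> by simp
      ultimately have "2 * B + \<bar>a - \<epsilon>\<bar> * \<rho> + \<bar>b\<bar> * \<bar>y\<bar> + \<bar>c + \<epsilon>\<bar> / 2 * y\<^sup>2 \<le> K * y ^ 4"
        by (simp add: K_def algebra_simps)
      moreover have "v (t - \<delta>) (x + y) \<le> B" "- B \<le> v t x"
        using bound[of "t - \<delta>" "x + y"] bound[of t x] \<delta> \<rho> t by auto
      moreover have "(a - \<epsilon>) * \<delta> \<le> \<bar>a - \<epsilon>\<bar> * \<rho>" using \<delta> by (intro mult_mono) auto
      moreover have "- (b * y) \<le> \<bar>b\<bar> * \<bar>y\<bar>" using abs_ge_minus_self[of "b * y"] by (simp add: abs_mult)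
      moreover have "- ((c + \<epsilon>) / 2 * y\<^sup>2) \<le> \<bar>c + \<epsilon>\<bar> / 2 * y\<^sup>2"
        using abs_ge_minus_self[of "(c + \<epsilon>) / 2 * y\<^sup>2"] by (simp add: abs_mult)
      ultimately show ?thesis by linarith
    qed
    have small: "a - \<epsilon> \<le> G (c + \<epsilon>) + \<delta> * (K * D)" if \<delta>: "0 < \<delta>" "\<delta> < \<rho>" for \<delta>
    proof -
      have "v t x \<le> v t x - (a - \<epsilon>) * \<delta> + \<delta> * G (c + \<epsilon>) + \<delta>\<^sup>2 * (K * D)"
        using \<delta> \<rho> by (intro step[OF _ _ K quartic]) auto
      then have "\<delta> * (a - \<epsilon>) \<le> \<delta> * (G (c + \<epsilon>) + \<delta> * (K * D))"
        by (simp add: algebra_simps power2_eq_square)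
      with \<delta> show ?thesis by simp
    qed
    have "((\<lambda>\<delta>. G (c + \<epsilon>) + \<delta> * (K * D)) \<longlongrightarrow> G (c + \<epsilon>) + 0 * (K * D)) (at_right 0)"
      by (intro tendsto_intros)
    then have "a - \<epsilon> \<le> G (c + \<epsilon>) + 0 * (K * D)"
      by (rule tendsto_lowerbound) (use small \<rho> in \<open>auto simp: eventually_at_right intro!: exI[of _ \<rho>]\<close>)
    then show ?thesis by simp
  qed
  have "((\<lambda>\<epsilon>. G (c + \<epsilon>) - (a - \<epsilon>)) \<longlongrightarrow> G (c + 0) - (a - 0)) (at_right 0)"
    using G by (intro tendsto_intros isCont_tendsto_compose[of _ G]) auto
  then have "0 \<le> G (c + 0) - (a - 0)"
    by (rule tendsto_lowerbound) (use perturbed in \<open>auto simp: eventually_at_right_field intro!: exI[of _ 1]\<close>)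
  then show "\<psi>t (t, x) - G (\<psi>xx (t, x)) \<le> 0" by (simp add: a_def c_def)
qed

text \<open>
  Negation exchanges the two notions, up to the reflection of \<open>G\<close>; so the supersolution property
  follows from the criterion for subsolutions.
\<close>

lemma viscosity_supersolution_via_negation:
  assumes "viscosity_subsolution (\<lambda>c. - G (- c)) (\<lambda>z. - u z)"
  shows "viscosity_supersolution G u"
  unfolding viscosity_supersolution_def
proof (intro allI impI, elim conjE)
  fix t x :: real and \<psi> \<psi>t \<psi>x \<psi>xx :: "real \<times> real \<Rightarrow> real"
  assume t: "0 < t" and \<psi>: "C12_derivs \<psi> \<psi>t \<psi>x \<psi>xx"
    and min: "\<forall>\<^sub>F z in nhds (t, x). u z - \<psi> z \<ge> u (t, x) - \<psi> (t, x)"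
  have "C12_derivs (\<lambda>z. - \<psi> z) (\<lambda>z. - \<psi>t z) (\<lambda>z. - \<psi>x z) (\<lambda>z. - \<psi>xx z)"
    using \<psi> unfolding C12_derivs_def by (auto intro!: DERIV_minus continuous_on_minus)
  moreover have "\<forall>\<^sub>F z in nhds (t, x). - u z - - \<psi> z \<le> - u (t, x) - - \<psi> (t, x)"
    using min by eventually_elim simp
  ultimately have "- \<psi>t (t, x) - (- G (- (- \<psi>xx (t, x)))) \<le> 0"
    using assms t unfolding viscosity_subsolution_def by blast
  then show "\<psi>t (t, x) - G (\<psi>xx (t, x)) \<ge> 0" by simp
qed

section \<open>Sums of independent identically distributed variables\<close>

locale centered_iid_sequence = sublinear_expectation_space +
  fixes X :: "nat \<Rightarrow> 'a \<Rightarrow> real"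
  assumes X_in_H: "1 \<le> i \<Longrightarrow> X i \<in> H"
    and iid: "iid \<P> H X"
    and mean_zero: "E (X 1) = 0" "E (\<lambda>\<omega>. - X 1 \<omega>) = 0"
begin

definition S :: "nat \<Rightarrow> 'a \<Rightarrow> real" where
  "S k \<omega> = (\<Sum>i=1..k. X i \<omega>)"

definition G :: "real \<Rightarrow> real" where
  "G = G_fun (- E (\<lambda>\<omega>. - (X 1 \<omega>)\<^sup>2)) (E (\<lambda>\<omega>. (X 1 \<omega>)\<^sup>2))"

text \<open>
  The functions to which the independence hypothesis can be applied. Phrasing the class through its
  effect on \<open>H\<close> lets polynomials inherit membership from the closure of \<open>H\<close> under sums.
\<close>

definition H_stable :: "(real \<Rightarrow> real) \<Rightarrow> bool" where
  "H_stable f \<longleftrightarrow> f \<in> borel_measurable borel \<and> (\<forall>Z\<in>H. (\<lambda>\<omega>. f (Z \<omega>)) \<in> H)"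

text \<open>
  The discrete nonlinear semigroup: \<open>k\<close> is time and \<open>s\<close> scales the increments.
\<close>

definition W :: "(real \<Rightarrow> real) \<Rightarrow> real \<Rightarrow> nat \<Rightarrow> real \<Rightarrow> real" where
  "W f s k x = E (\<lambda>\<omega>. f (x + s * S k \<omega>))"

lemma S_0: "S 0 \<omega> = 0" and S_1: "S 1 \<omega> = X 1 \<omega>"
  by (simp_all add: S_def)

lemma S_in_H: "S k \<in> H"
  unfolding S_def[abs_def] by (intro sum_in_H X_in_H) auto

lemma H_stable_C_lLip: "C_lLip f \<Longrightarrow> H_stable f"
  unfolding H_stable_def using C_lLip_continuous C_lLip_in_H borel_measurable_continuous_onI by blast

lemma H_stable_affine: "H_stable f \<Longrightarrow> Z \<in> H \<Longrightarrow> (\<lambda>\<omega>. f (x + s * Z \<omega>)) \<in> H"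
  using bspec[of H "\<lambda>Z. (\<lambda>\<omega>. f (Z \<omega>)) \<in> H", OF _ affine_in_H] unfolding H_stable_def by simp

lemma W_0: "W f s 0 x = f x"
  by (simp add: W_def S_0 E_const)

lemma W_1: "W f s 1 x = E (\<lambda>\<omega>. f (x + s * X 1 \<omega>))"
  by (simp only: W_def S_1)

text \<open>
  Independence of the last increment from the previous ones, applied to a function of the sum,
  integrates out the increment first; identical distribution replaces it by \<open>X 1\<close>. The membership
  in \<open>H\<close> is itself part of what independence asserts.
\<close>

lemma W_Suc:
  assumes f: "H_stable f"
  shows "(\<lambda>\<omega>. W f s 1 (x + s * S k \<omega>)) \<in> H"
    and "W f s (Suc k) x = W (W f s 1) s k x"
proof -
  have "(\<lambda>\<omega>. W f s 1 (x + s * S k \<omega>)) \<in> H \<and>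
    E (\<lambda>\<omega>. f (x + s * S (Suc k) \<omega>)) = E (\<lambda>\<omega>. W f s 1 (x + s * S k \<omega>))"
  proof (cases "k = 0")
    case True
    then show ?thesis by (simp add: S_0 const E_const W_def)
  next
    case False
    define \<phi> where "\<phi> z = f (x + s * (\<Sum>i=1..Suc k. z i))" for z :: "nat \<Rightarrow> real"
    have Z: "X (Suc k) \<in> H" "X 1 \<in> H" using X_in_H by auto
    have meas: "\<phi> \<in> borel_measurable (Rn (Suc k))"
    proof -
      have "(\<lambda>z. x + s * (\<Sum>i=1..Suc k. z i)) \<in> borel_measurable (Rn (Suc k))"
        by (intro borel_measurable_add borel_measurable_times borel_measurable_sum
            measurable_const measurable_component_singleton) auto
      moreover have "f \<in> borel_measurable borel" using f by (simp add: H_stable_def)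
      ultimately show ?thesis unfolding \<phi>_def by (rule measurable_compose)
    qed
    have past: "\<phi> ((\<lambda>i\<in>{1..k}. X i \<omega>)(Suc k := X (Suc k) \<omega>)) = f (x + s * S (Suc k) \<omega>)" for \<omega>
      unfolding \<phi>_def S_def by simp
    have fixed: "\<phi> (z(Suc k := X (Suc k) \<omega>)) = f (x + s * (\<Sum>i=1..k. z i) + s * X (Suc k) \<omega>)" for z \<omega>
      unfolding \<phi>_def by (simp add: algebra_simps)
    have bar: "E (\<lambda>\<omega>. \<phi> (z(Suc k := X (Suc k) \<omega>))) = W f s 1 (x + s * (\<Sum>i=1..k. z i))" for z
    proof -
      have "identically_distributed \<P> H (X (Suc k)) (X 1)" using iid by (simp add: iid_def)
      moreover have "(\<lambda>y. f (x + s * (\<Sum>i=1..k. z i) + s * y)) \<in> borel_measurable borel"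
        using f unfolding H_stable_def by (rule_tac measurable_compose[where N = borel and g = f]) auto
      ultimately show ?thesis
        unfolding fixed W_1 identically_distributed_def
        by (elim ballE[where x = "\<lambda>y. f (x + s * (\<Sum>i=1..k. z i) + s * y)"] impE)
           (simp_all add: H_stable_affine[OF f Z(1)] H_stable_affine[OF f Z(2)] del: One_nat_def)
    qed
    have pastbar: "(\<lambda>\<omega>. W f s 1 (x + s * (\<Sum>i=1..k. (\<lambda>i\<in>{1..k}. X i \<omega>) i))) = (\<lambda>\<omega>. W f s 1 (x + s * S k \<omega>))"
      by (simp add: S_def)
    have "independent_of \<P> H (X (Suc k)) k X" using iid False by (simp add: iid_def)
    from this[unfolded independent_of_def Let_def, rule_format, OF meas, unfolded past bar pastbar]
    show ?thesis
      using H_stable_affine[OF f S_in_H] H_stable_affine[OF f Z(1)] unfolding fixed by blast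
  qed
  then show "(\<lambda>\<omega>. W f s 1 (x + s * S k \<omega>)) \<in> H" "W f s (Suc k) x = W (W f s 1) s k x"
    by (auto simp: W_def)
qed

lemma X1_power_in_H: "(\<lambda>\<omega>. X 1 \<omega> ^ n) \<in> H"
  by (intro power_in_H X_in_H) simp

lemma S_power_in_H: "(\<lambda>\<omega>. S k \<omega> ^ n) \<in> H"
  by (intro power_in_H S_in_H)

lemma E_linear_X1: "Z \<in> H \<Longrightarrow> E (\<lambda>\<omega>. b * X 1 \<omega> + Z \<omega>) = E Z"
  by (intro E_mean_certain H_Dom X_in_H mean_zero) auto

lemma E_nonneg: "Z \<in> H \<Longrightarrow> (\<And>\<omega>. 0 \<le> Z \<omega>) \<Longrightarrow> 0 \<le> E Z"
  using E_mono[OF Dom_const[of 0] H_Dom] by (simp add: E_const)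

lemma E_half_square: "E (\<lambda>\<omega>. c / 2 * (X 1 \<omega>)\<^sup>2) = G c"
proof (cases "0 \<le> c")
  case True
  then show ?thesis
    using E_scale[OF H_Dom[OF X1_power_in_H], of "c / 2" 2] by (simp add: G_def G_fun_def)
next
  case False
  then show ?thesis
    using E_scale[OF H_Dom[OF scale[OF X1_power_in_H]], of "- c / 2" "-1" 2]
    by (simp add: G_def G_fun_def max_def)
qed

text \<open>
  Quadratic polynomials are reproduced by one step up to an additive constant: given the past, the
  terms linear in the increment are free of mean uncertainty, and only the pure square is left.
\<close>

lemma E_quadratic:
  "E (\<lambda>\<omega>. b * (s * S k \<omega>) + c / 2 * (s * S k \<omega>)\<^sup>2) = s\<^sup>2 * real k * G c"
proof (induction k)
  case 0
  then show ?case by (simp add: S_0 E_const)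
next
  case (Suc k)
  define f where "f y = b * y + c / 2 * y\<^sup>2" for y
  have f: "H_stable f"
    unfolding H_stable_def f_def by (intro conjI ballI add scale power_in_H) auto
  have T: "W f s 1 y = f y + s\<^sup>2 * G c" for y
  proof -
    have "W f s 1 y = E (\<lambda>\<omega>. (b * s + c * y * s) * X 1 \<omega> + (s\<^sup>2 * (c / 2 * (X 1 \<omega>)\<^sup>2) + f y))"
      unfolding W_1 f_def by (simp add: algebra_simps power2_eq_square)
    also have "\<dots> = E (\<lambda>\<omega>. s\<^sup>2 * (c / 2 * (X 1 \<omega>)\<^sup>2) + f y)"
      by (intro E_linear_X1 add scale const X1_power_in_H)
    also have "\<dots> = s\<^sup>2 * G c + f y"
      by (simp only: E_add_const E_scale E_half_square H_Dom scale X1_power_in_H zero_le_power2)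
    finally show ?thesis by simp
  qed
  have "E (\<lambda>\<omega>. f (s * S (Suc k) \<omega>)) = W (W f s 1) s k 0"
    using W_Suc(2)[OF f, of s k 0] by (simp add: W_def)
  also have "\<dots> = E (\<lambda>\<omega>. f (s * S k \<omega>) + s\<^sup>2 * G c)"
    by (simp only: W_def[of "W f s 1"] T add_0)
  also have "\<dots> = s\<^sup>2 * real k * G c + s\<^sup>2 * G c"
  proof -
    have "(\<lambda>\<omega>. f (s * S k \<omega>)) \<in> Dom"
      using H_stable_affine[OF f S_in_H, of 0 s k] by (simp add: H_Dom)
    from E_add_const[OF this] Suc show ?thesis by (simp only: f_def)
  qed
  finally show ?case unfolding f_def by (simp only: of_nat_Suc distrib_left distrib_right mult_1_right)
qed

definition var :: real where "var = E (\<lambda>\<omega>. (X 1 \<omega>)\<^sup>2)"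

lemma var_nonneg: "0 \<le> var"
  unfolding var_def by (intro E_nonneg X1_power_in_H) auto

lemma E_square: "E (\<lambda>\<omega>. (s * S k \<omega>)\<^sup>2) = s\<^sup>2 * real k * var"
  using E_quadratic[of 0 s k 2] by (simp add: G_def G_fun_def var_def)

text \<open>
  Sums of centred variables grow like \<open>sqrt k\<close> in every moment. One step increases the moment of
  order \<open>2 m + 2\<close> by a multiple of the moment of order \<open>2 m\<close> plus a constant, because the linear term of
  the binomial expansion has no mean uncertainty; summing over the steps raises the power of \<open>k\<close>
  by one.
\<close>

lemma E_even_power:
  "\<exists>D\<ge>0. \<forall>k. E (\<lambda>\<omega>. S k \<omega> ^ (2 * m)) \<le> D * real k ^ m"
proof (induction m)
  case 0
  then show ?case by (intro exI[of _ 1]) (simp add: E_const)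
next
  case (Suc m)
  then obtain D where D: "0 \<le> D" "\<And>k. E (\<lambda>\<omega>. S k \<omega> ^ (2 * m)) \<le> D * real k ^ m" by blast
  let ?N = "2 * m + 2"
  define a where "a = (2 :: real) ^ ?N"
  define M2 where "M2 = E (\<lambda>\<omega>. X 1 \<omega> ^ ?N)"
  define D' where "D' = a * (var * D + M2)"
  have nn: "0 \<le> a" "0 \<le> M2" "0 \<le> D'"
  proof -
    show "0 \<le> a" by (simp add: a_def)
    show "0 \<le> M2" unfolding M2_def by (intro E_nonneg X1_power_in_H zero_le_even_power) auto
    with \<open>0 \<le> a\<close> show "0 \<le> D'" using D(1) var_nonneg by (simp add: D'_def)
  qed
  have stable: "H_stable (\<lambda>y. y ^ ?N)" by (intro H_stable_C_lLip C_lLip_power)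
  have T: "W (\<lambda>y. y ^ ?N) 1 1 y \<le> y ^ ?N + a * (var * y ^ (2 * m) + M2)" for y
  proof -
    have "W (\<lambda>y. y ^ ?N) 1 1 y
      \<le> E (\<lambda>\<omega>. real ?N * y ^ (2 * m + 1) * X 1 \<omega>
            + ((a * y ^ (2 * m) * (X 1 \<omega>)\<^sup>2 + a * X 1 \<omega> ^ ?N) + y ^ ?N))"
      unfolding W_1
    proof (rule E_mono)
      show "(\<lambda>\<omega>. (y + 1 * X 1 \<omega>) ^ ?N) \<in> Dom"
        by (intro H_Dom power_in_H affine_in_H X_in_H) simp
      show "(\<lambda>\<omega>. real ?N * y ^ (2 * m + 1) * X 1 \<omega>
            + ((a * y ^ (2 * m) * (X 1 \<omega>)\<^sup>2 + a * X 1 \<omega> ^ ?N) + y ^ ?N)) \<in> Dom"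
        by (intro H_Dom add scale const X1_power_in_H X_in_H) simp
      show "(y + 1 * X 1 \<omega>) ^ ?N \<le> real ?N * y ^ (2 * m + 1) * X 1 \<omega>
            + ((a * y ^ (2 * m) * (X 1 \<omega>)\<^sup>2 + a * X 1 \<omega> ^ ?N) + y ^ ?N)" for \<omega>
        using binomial_square_bound[of y "X 1 \<omega>" m] unfolding a_def
        by (simp only: distrib_left mult_1 mult.assoc)
    qed
    also have "\<dots> = E (\<lambda>\<omega>. (a * y ^ (2 * m) * (X 1 \<omega>)\<^sup>2 + a * X 1 \<omega> ^ ?N) + y ^ ?N)"
      by (intro E_linear_X1 add scale const X1_power_in_H)
    also have "\<dots> = E (\<lambda>\<omega>. a * y ^ (2 * m) * (X 1 \<omega>)\<^sup>2 + a * X 1 \<omega> ^ ?N) + y ^ ?N"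
      by (intro E_add_const H_Dom add scale X1_power_in_H)
    also have "E (\<lambda>\<omega>. a * y ^ (2 * m) * (X 1 \<omega>)\<^sup>2 + a * X 1 \<omega> ^ ?N)
      \<le> E (\<lambda>\<omega>. a * y ^ (2 * m) * (X 1 \<omega>)\<^sup>2) + E (\<lambda>\<omega>. a * X 1 \<omega> ^ ?N)"
      by (intro E_add_le H_Dom scale X1_power_in_H)
    also have "\<dots> = a * y ^ (2 * m) * var + a * M2"
    proof -
      have "0 \<le> a * y ^ (2 * m)" using nn(1) zero_le_even_power[of "2 * m" y] by simp
      then show ?thesis
        unfolding var_def M2_def by (simp only: E_scale H_Dom X1_power_in_H nn(1))
    qed
    finally show ?thesis by (simp only: distrib_left mult_ac add_ac)
  qed
  have "E (\<lambda>\<omega>. S k \<omega> ^ ?N) \<le> D' * real k ^ Suc m" for k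
  proof (induction k)
    case 0
    then show ?case by (simp add: S_0 E_const)
  next
    case (Suc k)
    have "E (\<lambda>\<omega>. S (Suc k) \<omega> ^ ?N) = E (\<lambda>\<omega>. W (\<lambda>y. y ^ ?N) 1 1 (S k \<omega>))"
      using W_Suc(2)[OF stable, of 1 k 0] by (simp add: W_def)
    also have "\<dots> \<le> E (\<lambda>\<omega>. S k \<omega> ^ ?N + (a * var * S k \<omega> ^ (2 * m) + a * M2))"
    proof (rule E_mono)
      show "(\<lambda>\<omega>. W (\<lambda>y. y ^ ?N) 1 1 (S k \<omega>)) \<in> Dom"
        using H_Dom[OF W_Suc(1)[OF stable, of 1 0 k]] by simp
      show "(\<lambda>\<omega>. S k \<omega> ^ ?N + (a * var * S k \<omega> ^ (2 * m) + a * M2)) \<in> Dom"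
        by (intro H_Dom add scale const S_power_in_H)
      show "W (\<lambda>y. y ^ ?N) 1 1 (S k \<omega>) \<le> S k \<omega> ^ ?N + (a * var * S k \<omega> ^ (2 * m) + a * M2)" for \<omega>
        using T[of "S k \<omega>"] by (simp only: distrib_left mult_ac add_ac)
    qed
    also have "\<dots> \<le> E (\<lambda>\<omega>. S k \<omega> ^ ?N) + E (\<lambda>\<omega>. a * var * S k \<omega> ^ (2 * m) + a * M2)"
      by (intro E_add_le H_Dom add scale const S_power_in_H)
    also have "E (\<lambda>\<omega>. a * var * S k \<omega> ^ (2 * m) + a * M2) = a * var * E (\<lambda>\<omega>. S k \<omega> ^ (2 * m)) + a * M2"
    proof -
      have dom: "(\<lambda>\<omega>. a * var * S k \<omega> ^ (2 * m)) \<in> Dom"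
        by (intro H_Dom scale S_power_in_H)
      have "0 \<le> a * var" using nn(1) var_nonneg by simp
      from E_scale[OF H_Dom[OF S_power_in_H] this] show ?thesis
        by (simp only: E_add_const[OF dom])
    qed
    also have "a * var * E (\<lambda>\<omega>. S k \<omega> ^ (2 * m)) + a * M2 \<le> D' * real (Suc k) ^ m"
    proof -
      have "a * var * E (\<lambda>\<omega>. S k \<omega> ^ (2 * m)) \<le> a * var * (D * real (Suc k) ^ m)"
        using nn(1) var_nonneg D(1) power_mono[of "real k" "real (Suc k)" m]
        by (intro mult_left_mono order_trans[OF D(2)]) auto
      moreover have "a * M2 * 1 \<le> a * M2 * real (Suc k) ^ m"
        using nn by (intro mult_left_mono one_le_power) auto
      ultimately show ?thesis by (simp add: D'_def algebra_simps)
    qed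
    also have "E (\<lambda>\<omega>. S k \<omega> ^ ?N) \<le> D' * (real k * real (Suc k) ^ m)"
    proof -
      have "D' * real k ^ Suc m \<le> D' * (real k * real (Suc k) ^ m)"
        using nn(3) power_mono[of "real k" "real (Suc k)" m]
        unfolding power_Suc by (intro mult_left_mono) auto
      with Suc show ?thesis by simp
    qed
    also have "D' * (real k * real (Suc k) ^ m) + D' * real (Suc k) ^ m = D' * real (Suc k) ^ Suc m"
      by (simp add: distrib_right distrib_left)
    finally show ?case by simp
  qed
  with nn(3) show ?case by (intro exI[of _ D']) auto
qed

lemma E_even_power_scaled:
  assumes "E (\<lambda>\<omega>. S k \<omega> ^ (2 * m)) \<le> D * real k ^ m"
  shows "E (\<lambda>\<omega>. (s * S k \<omega>) ^ (2 * m)) \<le> D * (s\<^sup>2 * real k) ^ m"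
proof -
  have "E (\<lambda>\<omega>. (s * S k \<omega>) ^ (2 * m)) = (s\<^sup>2) ^ m * E (\<lambda>\<omega>. S k \<omega> ^ (2 * m))"
    unfolding power_mult_distrib power_mult[of s 2 m]
    by (intro E_scale H_Dom S_power_in_H) auto
  also have "\<dots> \<le> (s\<^sup>2) ^ m * (D * real k ^ m)"
    using assms by (intro mult_left_mono) auto
  finally show ?thesis by (simp add: power_mult_distrib algebra_simps)
qed

end

section \<open>The rescaled semigroup and its limits\<close>

context centered_iid_sequence begin

lemma bounded_Lipschitz_in_H:
  assumes "bounded_Lipschitz L B f" shows "(\<lambda>\<omega>. f (x + s * S k \<omega>)) \<in> H"
  by (intro H_stable_affine H_stable_C_lLip S_in_H bounded_LipschitzD(5)[OF assms])

lemma bounded_Lipschitz_W: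
  assumes f: "bounded_Lipschitz L B f" shows "bounded_Lipschitz L B (W f s k)"
  unfolding bounded_Lipschitz_def
proof (intro conjI allI)
  note dom = H_Dom[OF bounded_Lipschitz_in_H[OF f]]
  fix x y
  have "\<bar>W f s k x - W f s k y\<bar> \<le> E (\<lambda>_. L * \<bar>x - y\<bar>)"
    unfolding W_def using bounded_LipschitzD(1)[OF f]
    by (intro E_diff_le dom Dom_const) (metis add_diff_cancel_right)
  then show "\<bar>W f s k x - W f s k y\<bar> \<le> L * \<bar>x - y\<bar>" by (simp add: E_const)
  have "\<bar>W f s k x - E (\<lambda>_. 0)\<bar> \<le> E (\<lambda>_. B)"
    unfolding W_def using bounded_LipschitzD(2)[OF f] by (intro E_diff_le dom Dom_const) simp
  then show "\<bar>W f s k x\<bar> \<le> B" by (simp add: E_const)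
qed

text \<open>
  The increments are moved one at a time from the outer sum into the function, where each of them
  again yields a bounded Lipschitz function.
\<close>

lemma W_add:
  assumes "bounded_Lipschitz L B f" shows "W f s (j + k) x = W (W f s j) s k x"
  using assms
proof (induction j arbitrary: f)
  case 0
  then show ?case by (simp add: W_0[abs_def])
next
  case (Suc j)
  have "H_stable f" by (intro H_stable_C_lLip bounded_LipschitzD(5)[OF Suc.prems])
  note step = W_Suc(2)[OF this]
  have "W f s (Suc j + k) x = W (W f s 1) s (j + k) x" using step[of s "j + k" x] by simp
  also have "\<dots> = W (W (W f s 1) s j) s k x" by (rule Suc.IH[OF bounded_Lipschitz_W[OF Suc.prems]])
  also have "W (W f s 1) s j = W f s (Suc j)" by (rule ext) (rule step[symmetric])
  finally show ?case .
qed

text \<open>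
  The displacement \<open>s S\<^sub>k\<close> has mean square \<open>r\<^sup>2 var\<close> with \<open>r\<^sup>2 = s\<^sup>2 k\<close>. The inequality
  \<open>|y| \<le> (y\<^sup>2 / r + r) / 2\<close> turns this into a bound of order \<open>r\<close> on the mean of its absolute value, in
  place of the Cauchy-Schwarz inequality.
\<close>

lemma W_displacement:
  assumes f: "bounded_Lipschitz L B f"
  shows "\<bar>W f s k x - f x\<bar> \<le> L * ((1 + var) / 2) * sqrt (s\<^sup>2 * real k)"
proof -
  define r where "r = sqrt (s\<^sup>2 * real k)"
  have r: "0 \<le> r" "r\<^sup>2 = s\<^sup>2 * real k" by (simp_all add: r_def)
  note L = bounded_LipschitzD(3)[OF f]
  have Y2: "(\<lambda>\<omega>. (s * S k \<omega>)\<^sup>2) \<in> Dom" by (intro H_Dom power_in_H scale S_in_H)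
  have "\<bar>E (\<lambda>\<omega>. f (x + s * S k \<omega>)) - E (\<lambda>_. f x)\<bar>
      \<le> E (\<lambda>\<omega>. L / (2 * r) * (s * S k \<omega>)\<^sup>2 + L * r / 2)"
  proof (rule E_diff_le)
    show "(\<lambda>\<omega>. f (x + s * S k \<omega>)) \<in> Dom" by (intro H_Dom bounded_Lipschitz_in_H[OF f])
    show "(\<lambda>\<omega>. L / (2 * r) * (s * S k \<omega>)\<^sup>2 + L * r / 2) \<in> Dom" by (intro Dom_add Dom_scale Y2 Dom_const)
    fix \<omega>
    define y where "y = s * S k \<omega>"
    have "\<bar>y\<bar> \<le> (y\<^sup>2 / r + r) / 2"
    \<comment> \<open>for \<open>r = 0\<close> the displacement is zero, and so is the bound, as division by zero gives zero\<close>
    proof (cases "r = 0")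
      case True
      then have "s = 0 \<or> k = 0" by (auto simp: r_def)
      then show ?thesis by (auto simp: y_def S_0 True)
    next
      case False
      have "0 \<le> (\<bar>y\<bar> - r)\<^sup>2" by simp
      then have "2 * \<bar>y\<bar> * r \<le> y\<^sup>2 + r\<^sup>2" by (simp add: power2_diff)
      then show ?thesis using False r(1) by (simp add: field_simps power2_eq_square)
    qed
    then have "L * \<bar>y\<bar> \<le> L * ((y\<^sup>2 / r + r) / 2)" using L by (rule mult_left_mono)
    moreover have "\<bar>f (x + y) - f x\<bar> \<le> L * \<bar>y\<bar>" using bounded_LipschitzD(1)[OF f, of "x + y" x] by simp
    ultimately show "\<bar>f (x + s * S k \<omega>) - f x\<bar> \<le> L / (2 * r) * (s * S k \<omega>)\<^sup>2 + L * r / 2"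
      by (simp add: y_def[symmetric] field_simps)
  qed (rule Dom_const)
  also have "\<dots> = L / (2 * r) * (r\<^sup>2 * var) + L * r / 2"
    using r L by (subst E_add_const[OF Dom_scale[OF Y2]], subst E_scale[OF Y2]) (auto simp: E_square)
  also have "\<dots> = L * ((1 + var) / 2) * r"
    by (cases "r = 0") (simp_all add: field_simps power2_eq_square)
  finally show ?thesis by (simp add: W_def E_const r_def)
qed

text \<open>
  Parabolic rescaling: \<open>n\<close> steps of size \<open>1 / sqrt n\<close> per unit of time.
\<close>

definition V :: "(real \<Rightarrow> real) \<Rightarrow> nat \<Rightarrow> real \<Rightarrow> real \<Rightarrow> real" where
  "V f n t = W f (1 / sqrt (real n)) (nat \<lfloor>real n * t\<rfloor>)"

text \<open>
  Both times are rounded before subtracting, so that the number of steps is exactly additive.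
\<close>

definition steps :: "nat \<Rightarrow> real \<Rightarrow> real \<Rightarrow> nat" where
  "steps n s t = nat \<lfloor>real n * t\<rfloor> - nat \<lfloor>real n * s\<rfloor>"

lemma steps_bounds:
  assumes "1 \<le> n" "0 \<le> s" "s \<le> t"
  shows "\<bar>(1 / sqrt (real n))\<^sup>2 * real (steps n s t) - (t - s)\<bar> \<le> 1 / real n"
proof -
  have le: "\<lfloor>real n * s\<rfloor> \<le> \<lfloor>real n * t\<rfloor>" "0 \<le> \<lfloor>real n * s\<rfloor>"
    using assms by (auto intro!: floor_mono mult_left_mono)
  have "real (steps n s t) = of_int (\<lfloor>real n * t\<rfloor> - \<lfloor>real n * s\<rfloor>)"
    unfolding steps_def using le by (simp flip: nat_diff_distrib)
  then have "\<bar>real (steps n s t) - (real n * t - real n * s)\<bar> \<le> 1" by linarith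
  then have "\<bar>real (steps n s t) - (real n * t - real n * s)\<bar> / real n \<le> 1 / real n"
    by (intro divide_right_mono) auto
  moreover have "\<bar>real (steps n s t) - (real n * t - real n * s)\<bar> / real n
      = \<bar>(real (steps n s t) - (real n * t - real n * s)) / real n\<bar>" by (simp add: abs_divide)
  moreover have "(real (steps n s t) - (real n * t - real n * s)) / real n = real (steps n s t) / real n - (t - s)"
    using assms(1) by (simp add: field_simps)
  ultimately show ?thesis by (simp add: power_divide)
qed

lemma V_0: "V f n 0 x = f x"
  by (simp add: V_def W_0)

lemma bounded_Lipschitz_V: "bounded_Lipschitz L B f \<Longrightarrow> bounded_Lipschitz L B (V f n t)"
  unfolding V_def by (rule bounded_Lipschitz_W)

lemma V_dynamic_programming:
  assumes f: "bounded_Lipschitz L B f" and "s \<le> t"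
  shows "V f n t x = W (V f n s) (1 / sqrt (real n)) (steps n s t) x"
proof -
  have "nat \<lfloor>real n * t\<rfloor> = nat \<lfloor>real n * s\<rfloor> + steps n s t"
    unfolding steps_def using assms(2) by (simp add: nat_mono floor_mono mult_left_mono)
  then show ?thesis unfolding V_def using W_add[OF f] by simp
qed

text \<open>
  The Hoelder modulus in time comes from restarting the semigroup at the earlier time; the summand
  \<open>1 / n\<close> accounts for the rounding of the times to multiples of \<open>1 / n\<close>.
\<close>

lemma V_modulus:
  assumes f: "bounded_Lipschitz L B f" and n: "1 \<le> n" and ts: "0 \<le> t" "0 \<le> s"
  shows "\<bar>V f n t x - V f n s y\<bar> \<le> L * \<bar>x - y\<bar> + L * ((1 + var) / 2) * sqrt (\<bar>t - s\<bar> + 1 / real n)"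
proof -
  have c: "0 \<le> L * ((1 + var) / 2)" using bounded_LipschitzD(3)[OF f] var_nonneg by simp
  have ordered: "\<bar>V f n t x - V f n s x\<bar> \<le> L * ((1 + var) / 2) * sqrt (t - s + 1 / real n)"
    if "0 \<le> s" "s \<le> t" for s t
  proof -
    have "\<bar>V f n t x - V f n s x\<bar>
        \<le> L * ((1 + var) / 2) * sqrt ((1 / sqrt (real n))\<^sup>2 * real (steps n s t))"
      unfolding V_dynamic_programming[OF f that(2)] by (rule W_displacement[OF bounded_Lipschitz_V[OF f]])
    also have "\<dots> \<le> L * ((1 + var) / 2) * sqrt (t - s + 1 / real n)"
      using steps_bounds[OF n that] c by (intro mult_left_mono real_sqrt_le_mono) auto
    finally show ?thesis .
  qed
  have "\<bar>V f n t x - V f n s x\<bar> \<le> L * ((1 + var) / 2) * sqrt (\<bar>t - s\<bar> + 1 / real n)"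
  proof (cases "s \<le> t")
    case True
    with ordered[of s t] ts show ?thesis by simp
  next
    case False
    then have "\<bar>t - s\<bar> = s - t" by simp
    with ordered[of t s] ts False show ?thesis by (simp only: abs_minus_commute)
  qed
  moreover have "\<bar>V f n s x - V f n s y\<bar> \<le> L * \<bar>x - y\<bar>"
    by (rule bounded_LipschitzD(1)[OF bounded_Lipschitz_V[OF f]])
  ultimately show ?thesis by linarith
qed

lemma V_subsequence:
  assumes f: "bounded_Lipschitz L B f" and r: "strict_mono (r :: nat \<Rightarrow> nat)"
  obtains q v where "strict_mono (q :: nat \<Rightarrow> nat)"
    "\<And>t x. 0 \<le> t \<Longrightarrow> (\<lambda>i. V f (r (q i)) t x) \<longlonglongrightarrow> v t x"
proof -
  let ?S = "{0..} \<times> (UNIV :: real set)" and ?F = "\<lambda>n z. V f (r n) (fst z) (snd z)"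
  define c where "c = L * ((1 + var) / 2)"
  have c: "0 \<le> c" "0 \<le> L" using bounded_LipschitzD(3)[OF f] var_nonneg by (auto simp: c_def)
  have equi: "\<exists>d>0. \<forall>\<^sub>F n in sequentially. \<forall>w\<in>?S. dist w z < d \<longrightarrow> \<bar>?F n w - ?F n z\<bar> < \<epsilon>"
    if z: "z \<in> ?S" and \<epsilon>: "0 < \<epsilon>" for z \<epsilon>
  proof -
    have "((\<lambda>h. L * h + c * sqrt (h + h)) \<longlongrightarrow> L * 0 + c * sqrt (0 + 0)) (at_right 0)"
      by (intro tendsto_intros)
    then have "\<forall>\<^sub>F h in at_right 0. L * h + c * sqrt (h + h) < \<epsilon>"
      using \<epsilon> by (intro order_tendstoD(2)) auto
    then obtain b where b: "0 < b" "\<And>h. 0 < h \<Longrightarrow> h < b \<Longrightarrow> L * h + c * sqrt (h + h) < \<epsilon>"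
      unfolding eventually_at_right_field by blast
    define h where "h = b / 2"
    have h: "0 < h" "L * h + c * sqrt (h + h) < \<epsilon>"
    proof -
      have "0 < b / 2" "b / 2 < b" using b(1) by auto
      with b(2)[of "b / 2"] show "0 < h" "L * h + c * sqrt (h + h) < \<epsilon>"
        unfolding h_def by blast+
    qed
    have "\<forall>\<^sub>F n in sequentially. \<forall>w\<in>?S. dist w z < h \<longrightarrow> \<bar>?F n w - ?F n z\<bar> < \<epsilon>"
      using eventually_ge_at_top[of "nat \<lceil>1 / h\<rceil> + 1"]
    proof eventually_elim
      case (elim n)
      then have rn: "1 \<le> r n" "1 / h \<le> real (r n)" using seq_suble[OF r, of n] by linarith+
      then have n: "1 / real (r n) \<le> h" using h(1) by (simp add: field_simps)
      show ?case
      proof (intro ballI impI)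
        fix w assume w: "w \<in> ?S" "dist w z < h"
        have d: "\<bar>fst w - fst z\<bar> \<le> h" "\<bar>snd w - snd z\<bar> \<le> h"
          using w(2) dist_fst_le[of w z] dist_snd_le[of w z] by (auto simp: dist_real_def)
        have "\<bar>?F n w - ?F n z\<bar> \<le> L * \<bar>snd w - snd z\<bar> + c * sqrt (\<bar>fst w - fst z\<bar> + 1 / real (r n))"
          unfolding c_def using w z by (intro V_modulus[OF f rn(1)]) auto
        also have "\<dots> \<le> L * h + c * sqrt (h + h)"
          using c d n by (intro add_mono mult_left_mono real_sqrt_le_mono) auto
        finally show "\<bar>?F n w - ?F n z\<bar> < \<epsilon>" using h(2) by linarith
      qed
    qed
    with h(1) show ?thesis by blast
  qed
  show thesis
  proof (rule asymptotically_equicontinuous_subsequence[of ?S ?F B, OF _ equi])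
    show "\<bar>?F n z\<bar> \<le> B" for n z
      by (rule bounded_LipschitzD(2)[OF bounded_Lipschitz_V[OF f]])
    fix q :: "nat \<Rightarrow> nat" and g
    assume q: "strict_mono q" and g: "\<And>z. z \<in> ?S \<Longrightarrow> (\<lambda>i. ?F (q i) z) \<longlonglongrightarrow> g z"
    show thesis
    proof (rule that[OF q])
      show "(\<lambda>i. V f (r (q i)) t x) \<longlonglongrightarrow> g (t, x)" if "0 \<le> t" for t x
        using g[of "(t, x)"] that by simp
    qed
  qed
qed

end

text \<open>
  A limit of the rescaled functions along a subsequence, with initial value \<open>f\<close>.
\<close>

locale scaling_limit = centered_iid_sequence M \<P> H X
  for M :: "'a measure" and \<P> H X +
  fixes L B :: real and f :: "real \<Rightarrow> real" and q :: "nat \<Rightarrow> nat" and v :: "real \<Rightarrow> real \<Rightarrow> real"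
  assumes f: "bounded_Lipschitz L B f"
    and q: "strict_mono q"
    and lim: "0 \<le> t \<Longrightarrow> (\<lambda>i. V f (q i) t x) \<longlonglongrightarrow> v t x"
begin

lemma q_tendsto: "(\<lambda>i. 1 / real (q i)) \<longlonglongrightarrow> 0"
  using LIMSEQ_subseq_LIMSEQ[OF lim_1_over_n q] by (simp add: comp_def)

lemma q_ge_1: "\<forall>\<^sub>F i in sequentially. 1 \<le> q i"
  using eventually_ge_at_top[of 1] by eventually_elim (use seq_suble[OF q] order_trans in blast)

lemma bounded_Lipschitz_v:
  assumes "0 \<le> t" shows "bounded_Lipschitz L B (v t)"
  unfolding bounded_Lipschitz_def
proof (intro conjI allI)
  note V = bounded_LipschitzD[OF bounded_Lipschitz_V[OF f]]
  show "\<bar>v t x - v t y\<bar> \<le> L * \<bar>x - y\<bar>" for x y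
    by (rule LIMSEQ_le_const2[OF tendsto_rabs[OF tendsto_diff[OF lim lim]]]) (use assms V(1) in auto)
  show "\<bar>v t x\<bar> \<le> B" for x
    by (rule LIMSEQ_le_const2[OF tendsto_rabs[OF lim]]) (use assms V(2) in auto)
qed

lemma v_0: "v 0 x = f x"
  using LIMSEQ_unique[OF lim[of 0 x]] by (simp add: V_0)

lemma v_modulus:
  assumes "0 \<le> t" "0 \<le> s"
  shows "\<bar>v t x - v s y\<bar> \<le> L * \<bar>x - y\<bar> + L * ((1 + var) / 2) * sqrt \<bar>t - s\<bar>"
proof (rule tendsto_le[OF sequentially_bot])
  show "(\<lambda>i. \<bar>V f (q i) t x - V f (q i) s y\<bar>) \<longlonglongrightarrow> \<bar>v t x - v s y\<bar>"
    by (intro tendsto_intros lim assms)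
  have "(\<lambda>i. L * \<bar>x - y\<bar> + L * ((1 + var) / 2) * sqrt (\<bar>t - s\<bar> + 1 / real (q i)))
      \<longlonglongrightarrow> L * \<bar>x - y\<bar> + L * ((1 + var) / 2) * sqrt (\<bar>t - s\<bar> + 0)"
    by (intro tendsto_add tendsto_mult tendsto_const tendsto_real_sqrt q_tendsto)
  then show "(\<lambda>i. L * \<bar>x - y\<bar> + L * ((1 + var) / 2) * sqrt (\<bar>t - s\<bar> + 1 / real (q i)))
      \<longlonglongrightarrow> L * \<bar>x - y\<bar> + L * ((1 + var) / 2) * sqrt \<bar>t - s\<bar>" by simp
  show "\<forall>\<^sub>F i in sequentially. \<bar>V f (q i) t x - V f (q i) s y\<bar>
      \<le> L * \<bar>x - y\<bar> + L * ((1 + var) / 2) * sqrt (\<bar>t - s\<bar> + 1 / real (q i))"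
    using q_ge_1 by eventually_elim (rule V_modulus[OF f _ assms])
qed

lemma continuous_v: "continuous_on ({0..} \<times> UNIV) (\<lambda>(t, x). v t x)"
  unfolding continuous_on_def
proof
  fix z :: "real \<times> real" assume z: "z \<in> {0..} \<times> UNIV"
  let ?S = "{0..} \<times> (UNIV :: real set)" and ?v = "\<lambda>(t, x). v t x"
  let ?m = "\<lambda>w. L * \<bar>snd w - snd z\<bar> + L * ((1 + var) / 2) * sqrt \<bar>fst w - fst z\<bar>"
  have "(?m \<longlongrightarrow> L * \<bar>snd z - snd z\<bar> + L * ((1 + var) / 2) * sqrt \<bar>fst z - fst z\<bar>) (at z within ?S)"
    by (intro tendsto_intros)
  then have "(?m \<longlongrightarrow> 0) (at z within ?S)" by simp
  moreover have "\<forall>\<^sub>F w in at z within ?S. norm (?v w - ?v z) \<le> ?m w"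
  proof -
    have "norm (?v w - ?v z) \<le> ?m w" if "w \<in> ?S" for w
      using v_modulus[of "fst w" "fst z" "snd w" "snd z"] that z
      by (simp add: case_prod_beta' mem_Times_iff)
    then show ?thesis by (auto simp: eventually_at_filter)
  qed
  ultimately have "((\<lambda>w. ?v w - ?v z) \<longlongrightarrow> 0) (at z within ?S)"
    by (rule Lim_null_comparison[rotated])
  then show "(?v \<longlongrightarrow> ?v z) (at z within ?S)" by (rule LIM_zero_cancel)
qed

text \<open>
  The size of one increment along the subsequence, and the time that elapses between the roundings
  of \<open>s\<close> and \<open>t\<close>.
\<close>

abbreviation \<sigma> :: "nat \<Rightarrow> real" where "\<sigma> i \<equiv> 1 / sqrt (real (q i))"

abbreviation \<tau> :: "real \<Rightarrow> real \<Rightarrow> nat \<Rightarrow> real" where "\<tau> s t i \<equiv> (\<sigma> i)\<^sup>2 * real (steps (q i) s t)"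

lemma \<tau>_tendsto:
  assumes "0 \<le> s" "s \<le> t" shows "\<tau> s t \<longlonglongrightarrow> t - s"
proof (rule LIM_zero_cancel, rule Lim_null_comparison[OF _ q_tendsto])
  show "\<forall>\<^sub>F i in sequentially. norm (\<tau> s t i - (t - s)) \<le> 1 / real (q i)"
    using q_ge_1 by eventually_elim (use steps_bounds assms in auto)
qed

text \<open>
  The principle holds exactly for the rescaled functions, with \<open>V\<close> in place of \<open>v\<close> inside the
  expectation. Replacing \<open>V\<close> by its limit costs little: on a large ball the convergence is uniform,
  and outside a ball of radius \<open>sqrt R\<close> the difference is at most \<open>2 B \<le> (2 B / R) y\<^sup>2\<close>, whose
  expectation is controlled by the variance of the increment.
\<close>

lemma v_dynamic_programming:
  assumes st: "0 \<le> s" "s \<le> t"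
  shows "(\<lambda>i. W (v s) (\<sigma> i) (steps (q i) s t) x) \<longlonglongrightarrow> v t x"
proof -
  note v = bounded_Lipschitz_v[OF st(1)] and V = bounded_Lipschitz_V[OF f]
  have B: "0 \<le> B" by (rule bounded_LipschitzD(4)[OF f])
  have "(\<lambda>i. W (v s) (\<sigma> i) (steps (q i) s t) x - V f (q i) t x) \<longlonglongrightarrow> 0"
  proof (rule tendstoI)
    fix e :: real assume e: "0 < e"
    \<comment> \<open>large enough that the contribution from outside the ball is at most \<open>e / 3\<close>\<close>
    define R where "R = 6 * B * (t - s + 1) * var / e + 1"
    have R: "0 < R" "2 * B / R * ((t - s + 1) * var) \<le> e / 3"
    proof -
      have R1: "1 \<le> R" unfolding R_def using B st e var_nonneg by simp
      then show "0 < R" by simp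
      have "6 * B * (t - s + 1) * var \<le> e * R" unfolding R_def using e by (simp add: field_simps)
      with R1 show "2 * B / R * ((t - s + 1) * var) \<le> e / 3" by (simp add: field_simps)
    qed
    have "\<forall>\<^sub>F i in sequentially. \<forall>y\<in>{x - sqrt R..x + sqrt R}. \<bar>V f (q i) s y - v s y\<bar> \<le> e / 3"
      using e by (intro pointwise_limit_of_Lipschitz_uniform[where L = L] lim st bounded_LipschitzD(1)[OF V]) auto
    moreover have "\<forall>\<^sub>F i in sequentially. \<tau> s t i < t - s + 1"
      by (rule order_tendstoD(2)[OF \<tau>_tendsto[OF st]]) simp
    ultimately show "\<forall>\<^sub>F i in sequentially. dist (W (v s) (\<sigma> i) (steps (q i) s t) x - V f (q i) t x) 0 < e"
    proof eventually_elim
      case (elim i)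
      let ?k = "steps (q i) s t"
      have Y2: "(\<lambda>\<omega>. (\<sigma> i * S ?k \<omega>)\<^sup>2) \<in> Dom" by (intro H_Dom power_in_H scale S_in_H)
      have "\<bar>W (v s) (\<sigma> i) ?k x - W (V f (q i) s) (\<sigma> i) ?k x\<bar>
          \<le> E (\<lambda>\<omega>. 2 * B / R * (\<sigma> i * S ?k \<omega>)\<^sup>2 + e / 3)"
        unfolding W_def
      proof (rule E_diff_le)
        fix \<omega>
        define y where "y = \<sigma> i * S ?k \<omega>"
        have "\<bar>v s (x + y) - V f (q i) s (x + y)\<bar> \<le> 2 * B / R * y\<^sup>2 + e / 3"
        proof (cases "\<bar>y\<bar> \<le> sqrt R")
          case True
          then have "\<bar>v s (x + y) - V f (q i) s (x + y)\<bar> \<le> e / 3"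
            using elim(1) by (auto simp: abs_minus_commute abs_le_iff)
          moreover have "0 \<le> 2 * B / R * y\<^sup>2" using B R by simp
          ultimately show ?thesis by linarith
        next
          case False
          then have "R \<le> y\<^sup>2" using R(1) real_le_rsqrt[of "\<bar>y\<bar>" R]
            by (metis linear power2_abs real_le_lsqrt real_sqrt_le_iff real_sqrt_abs)
          then have "2 * B / R * R \<le> 2 * B / R * y\<^sup>2" using B R by (intro mult_left_mono) auto
          moreover have "\<bar>v s (x + y) - V f (q i) s (x + y)\<bar> \<le> 2 * B"
            using bounded_LipschitzD(2)[OF v, of "x + y"] bounded_LipschitzD(2)[OF V, of "q i" s "x + y"]
            by linarith
          ultimately show ?thesis using R(1) e by simp
        qed
        then show "\<bar>v s (x + \<sigma> i * S ?k \<omega>) - V f (q i) s (x + \<sigma> i * S ?k \<omega>)\<bar>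
            \<le> 2 * B / R * (\<sigma> i * S ?k \<omega>)\<^sup>2 + e / 3" by (simp add: y_def)
      qed (intro H_Dom bounded_Lipschitz_in_H[OF v] bounded_Lipschitz_in_H[OF V]
            Dom_add Dom_scale Y2 Dom_const)+
      also have "\<dots> = 2 * B / R * (\<tau> s t i * var) + e / 3"
        using B R by (simp only: E_add_const[OF Dom_scale[OF Y2]] E_scale[OF Y2] E_square divide_nonneg_nonneg
            mult_nonneg_nonneg less_imp_le zero_le_numeral)
      also have "\<dots> \<le> 2 * B / R * ((t - s + 1) * var) + e / 3"
        using B R(1) elim(2) var_nonneg by (intro add_mono mult_left_mono mult_right_mono) auto
      also have "\<dots> < e" using R(2) e by linarith
      finally show ?case using V_dynamic_programming[OF f st(2), of "q i" x] by simp
    qed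
  qed
  from tendsto_add[OF this lim[of t x]] st show ?thesis by simp
qed

text \<open>
  The linear term drops out, the quadratic one contributes \<open>(t - s) G c\<close> in the limit, and the fourth
  moment of the increment is of the order of the square of its duration.
\<close>

lemma v_upper_step:
  assumes D: "\<And>k. E (\<lambda>\<omega>. S k \<omega> ^ (2 * 2)) \<le> D * real k ^ 2"
    and st: "0 \<le> s" "s \<le> t" and K: "0 \<le> K"
    and le: "\<And>y. v s (x + y) \<le> A + b * y + c / 2 * y\<^sup>2 + K * y ^ 4"
  shows "v t x \<le> A + (t - s) * G c + (t - s)\<^sup>2 * (K * D)"
proof (rule tendsto_le[OF sequentially_bot])
  show "(\<lambda>i. W (v s) (\<sigma> i) (steps (q i) s t) x) \<longlonglongrightarrow> v t x"
    by (rule v_dynamic_programming[OF st])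
  show "(\<lambda>i. A + \<tau> s t i * G c + (\<tau> s t i)\<^sup>2 * (K * D)) \<longlonglongrightarrow> A + (t - s) * G c + (t - s)\<^sup>2 * (K * D)"
    by (intro tendsto_add tendsto_mult tendsto_power tendsto_const \<tau>_tendsto st)
  show "\<forall>\<^sub>F i in sequentially. W (v s) (\<sigma> i) (steps (q i) s t) x
      \<le> A + \<tau> s t i * G c + (\<tau> s t i)\<^sup>2 * (K * D)"
  proof (rule always_eventually, rule allI)
    fix i
    define Y where "Y \<omega> = \<sigma> i * S (steps (q i) s t) \<omega>" for \<omega>
    have Y: "Y \<in> H" unfolding Y_def[abs_def] by (intro scale S_in_H)
    have quad: "(\<lambda>\<omega>. b * Y \<omega> + c / 2 * (Y \<omega>)\<^sup>2) \<in> Dom" by (intro H_Dom add scale power_in_H Y)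
    have Y4: "(\<lambda>\<omega>. Y \<omega> ^ 4) \<in> Dom" by (intro H_Dom power_in_H Y)
    have "W (v s) (\<sigma> i) (steps (q i) s t) x
        \<le> E (\<lambda>\<omega>. (b * Y \<omega> + c / 2 * (Y \<omega>)\<^sup>2) + (K * Y \<omega> ^ 4 + A))"
      unfolding W_def Y_def[symmetric]
    proof (rule E_mono)
      show "(\<lambda>\<omega>. v s (x + Y \<omega>)) \<in> Dom"
        unfolding Y_def by (intro H_Dom bounded_Lipschitz_in_H[OF bounded_Lipschitz_v[OF st(1)]])
      show "(\<lambda>\<omega>. (b * Y \<omega> + c / 2 * (Y \<omega>)\<^sup>2) + (K * Y \<omega> ^ 4 + A)) \<in> Dom"
        by (intro Dom_add[OF quad] Dom_add Dom_scale Y4 Dom_const)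
      show "v s (x + Y \<omega>) \<le> (b * Y \<omega> + c / 2 * (Y \<omega>)\<^sup>2) + (K * Y \<omega> ^ 4 + A)" for \<omega>
        using le[of "Y \<omega>"] by linarith
    qed
    also have "\<dots> \<le> E (\<lambda>\<omega>. b * Y \<omega> + c / 2 * (Y \<omega>)\<^sup>2) + E (\<lambda>\<omega>. K * Y \<omega> ^ 4 + A)"
      by (intro E_add_le[OF quad] Dom_add Dom_scale Y4 Dom_const)
    also have "E (\<lambda>\<omega>. b * Y \<omega> + c / 2 * (Y \<omega>)\<^sup>2) = \<tau> s t i * G c"
      unfolding Y_def by (rule E_quadratic)
    also have "E (\<lambda>\<omega>. K * Y \<omega> ^ 4 + A) = K * E (\<lambda>\<omega>. Y \<omega> ^ 4) + A"
      by (simp only: E_add_const[OF Dom_scale[OF Y4]] E_scale[OF Y4 K])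
    also have "K * E (\<lambda>\<omega>. Y \<omega> ^ 4) \<le> K * (D * (\<tau> s t i)\<^sup>2)"
      using E_even_power_scaled[OF D, of "\<sigma> i"] unfolding Y_def by (intro mult_left_mono K) simp
    finally show "W (v s) (\<sigma> i) (steps (q i) s t) x \<le> A + \<tau> s t i * G c + (\<tau> s t i)\<^sup>2 * (K * D)"
      by (simp add: mult_ac)
  qed
qed

text \<open>
  The expectation is not symmetric, so this does not follow from the upper bound by negation:
  the quadratic polynomial is dominated by \<open>v\<close> plus the quartic term, and subadditivity separates
  the two.
\<close>

lemma v_lower_step:
  assumes D: "\<And>k. E (\<lambda>\<omega>. S k \<omega> ^ (2 * 2)) \<le> D * real k ^ 2"
    and st: "0 \<le> s" "s \<le> t" and K: "0 \<le> K"
    and ge: "\<And>y. A + b * y + c / 2 * y\<^sup>2 - K * y ^ 4 \<le> v s (x + y)"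
  shows "A + (t - s) * G c - (t - s)\<^sup>2 * (K * D) \<le> v t x"
proof (rule tendsto_le[OF sequentially_bot])
  show "(\<lambda>i. W (v s) (\<sigma> i) (steps (q i) s t) x) \<longlonglongrightarrow> v t x"
    by (rule v_dynamic_programming[OF st])
  show "(\<lambda>i. A + \<tau> s t i * G c - (\<tau> s t i)\<^sup>2 * (K * D)) \<longlonglongrightarrow> A + (t - s) * G c - (t - s)\<^sup>2 * (K * D)"
    by (intro tendsto_add tendsto_diff tendsto_mult tendsto_power tendsto_const \<tau>_tendsto st)
  show "\<forall>\<^sub>F i in sequentially. A + \<tau> s t i * G c - (\<tau> s t i)\<^sup>2 * (K * D)
      \<le> W (v s) (\<sigma> i) (steps (q i) s t) x"
  proof (rule always_eventually, rule allI)
    fix i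
    define Y where "Y \<omega> = \<sigma> i * S (steps (q i) s t) \<omega>" for \<omega>
    have Y: "Y \<in> H" unfolding Y_def[abs_def] by (intro scale S_in_H)
    have quad: "(\<lambda>\<omega>. b * Y \<omega> + c / 2 * (Y \<omega>)\<^sup>2) \<in> Dom" by (intro H_Dom add scale power_in_H Y)
    have Y4: "(\<lambda>\<omega>. Y \<omega> ^ 4) \<in> Dom" by (intro H_Dom power_in_H Y)
    have vY: "(\<lambda>\<omega>. v s (x + Y \<omega>)) \<in> Dom"
      unfolding Y_def by (intro H_Dom bounded_Lipschitz_in_H[OF bounded_Lipschitz_v[OF st(1)]])
    have rest: "(\<lambda>\<omega>. K * Y \<omega> ^ 4 + - A) \<in> Dom" by (intro Dom_add Dom_scale Y4 Dom_const)
    have "\<tau> s t i * G c = E (\<lambda>\<omega>. b * Y \<omega> + c / 2 * (Y \<omega>)\<^sup>2)"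
      unfolding Y_def by (rule E_quadratic[symmetric])
    also have "\<dots> \<le> E (\<lambda>\<omega>. v s (x + Y \<omega>) + (K * Y \<omega> ^ 4 + - A))"
    proof (rule E_mono[OF quad Dom_add[OF vY rest]])
      show "b * Y \<omega> + c / 2 * (Y \<omega>)\<^sup>2 \<le> v s (x + Y \<omega>) + (K * Y \<omega> ^ 4 + - A)" for \<omega>
        using ge[of "Y \<omega>"] by linarith
    qed
    also have "\<dots> \<le> E (\<lambda>\<omega>. v s (x + Y \<omega>)) + E (\<lambda>\<omega>. K * Y \<omega> ^ 4 + - A)"
      by (rule E_add_le[OF vY rest])
    also have "E (\<lambda>\<omega>. K * Y \<omega> ^ 4 + - A) = K * E (\<lambda>\<omega>. Y \<omega> ^ 4) + - A"
      by (simp only: E_add_const[OF Dom_scale[OF Y4]] E_scale[OF Y4 K])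
    also have "K * E (\<lambda>\<omega>. Y \<omega> ^ 4) \<le> K * (D * (\<tau> s t i)\<^sup>2)"
      using E_even_power_scaled[OF D, of "\<sigma> i"] unfolding Y_def by (intro mult_left_mono K) simp
    finally have "A + \<tau> s t i * G c - K * (D * (\<tau> s t i)\<^sup>2) \<le> E (\<lambda>\<omega>. v s (x + Y \<omega>))"
      by linarith
    then show "A + \<tau> s t i * G c - (\<tau> s t i)\<^sup>2 * (K * D) \<le> W (v s) (\<sigma> i) (steps (q i) s t) x"
      by (simp add: mult_ac W_def Y_def)
  qed
qed

lemma isCont_G: "isCont G c"
  unfolding G_def G_fun_def[abs_def] by (intro continuous_intros continuous_max) simp

lemma viscosity_solution_v: "viscosity_solution G f (\<lambda>(t, x). v t x)"
proof -
  obtain D where D: "\<And>k. E (\<lambda>\<omega>. S k \<omega> ^ (2 * 2)) \<le> D * real k ^ 2"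
    using E_even_power[of 2] by blast
  note v_bound = bounded_LipschitzD(2)[OF bounded_Lipschitz_v]
  have "viscosity_subsolution G (\<lambda>(t, x). v t x)"
  proof (rule viscosity_subsolution_of_quartic_bound[OF isCont_G v_bound])
    fix t \<delta> x A b c K :: real
    assume "0 < \<delta>" "\<delta> \<le> t" "0 \<le> K" "\<And>y. v (t - \<delta>) (x + y) \<le> A + b * y + c / 2 * y\<^sup>2 + K * y ^ 4"
    then show "v t x \<le> A + \<delta> * G c + \<delta>\<^sup>2 * (K * D)"
      using v_upper_step[OF D, of "t - \<delta>" t K x A b c] by simp
  qed
  moreover have "viscosity_supersolution G (\<lambda>(t, x). v t x)"
  proof (rule viscosity_supersolution_via_negation)
    have "viscosity_subsolution (\<lambda>c. - G (- c)) (\<lambda>(t, x). - v t x)"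
    proof (rule viscosity_subsolution_of_quartic_bound)
      show "isCont (\<lambda>c. - G (- c)) c" for c
        by (intro continuous_minus isCont_o2[OF _ isCont_G] continuous_ident)
      show "\<bar>- v t x\<bar> \<le> B" if "0 \<le> t" for t x using v_bound[OF that] by simp
      fix t \<delta> x A b c K :: real
      assume *: "0 < \<delta>" "\<delta> \<le> t" "0 \<le> K"
        and le: "\<And>y. - v (t - \<delta>) (x + y) \<le> A + b * y + c / 2 * y\<^sup>2 + K * y ^ 4"
      have "- A + (t - (t - \<delta>)) * G (- c) - (t - (t - \<delta>))\<^sup>2 * (K * D) \<le> v t x"
      proof (rule v_lower_step[OF D])
        show "- A + (- b) * y + (- c) / 2 * y\<^sup>2 - K * y ^ 4 \<le> v (t - \<delta>) (x + y)" for y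
          using le[of y] by simp
      qed (use * in auto)
      then show "- v t x \<le> A + \<delta> * - G (- c) + \<delta>\<^sup>2 * (K * D)" by simp
    qed
    then show "viscosity_subsolution (\<lambda>c. - G (- c)) (\<lambda>z. - (case z of (t, x) \<Rightarrow> v t x))"
      by (simp add: case_prod_beta')
  qed
  ultimately show ?thesis
    using continuous_v v_0 by (simp add: viscosity_solution_def)
qed

lemma polynomial_growth_v: "polynomial_growth (\<lambda>(t, x). v t x)"
  unfolding polynomial_growth_def
proof (intro allI impI)
  fix T :: real
  have "\<bar>v t x\<bar> \<le> (B + 1) * (1 + \<bar>x\<bar> ^ 0)" if "t \<in> {0..T}" for t x
    using bounded_LipschitzD(2)[OF bounded_Lipschitz_v, of t x] bounded_LipschitzD(4)[OF f] that by auto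
  then show "\<exists>C>0. \<exists>m. \<forall>t\<in>{0..T}. \<forall>x. \<bar>case (t, x) of (t, x) \<Rightarrow> v t x\<bar> \<le> C * (1 + \<bar>x\<bar> ^ m)"
    using bounded_LipschitzD(4)[OF f] by (intro exI[of _ "B + 1"] conjI exI[of _ 0]) auto
qed

end

section \<open>The central limit theorem\<close>

lemma (in sublinear_expectation_space) E_approximation:
  assumes Z: "Z \<in> H" and \<phi>: "continuous_on UNIV \<phi>" and f: "C_lLip f" and \<epsilon>: "0 \<le> \<epsilon>"
    and le: "\<And>x. \<bar>\<phi> x - f x\<bar> \<le> \<epsilon> * (1 + x ^ (2 * q))"
  shows "\<bar>E (\<lambda>\<omega>. \<phi> (Z \<omega>)) - E (\<lambda>\<omega>. f (Z \<omega>))\<bar> \<le> \<epsilon> * (1 + E (\<lambda>\<omega>. Z \<omega> ^ (2 * q)))"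
proof -
  have fZ: "(\<lambda>\<omega>. f (Z \<omega>)) \<in> H" by (rule C_lLip_in_H[OF Z f])
  have pow: "(\<lambda>\<omega>. \<epsilon> * (1 + Z \<omega> ^ (2 * q))) \<in> H" by (intro scale add const power_in_H Z)
  have "(\<lambda>\<omega>. \<phi> (Z \<omega>)) \<in> Dom"
  proof (rule DomI[OF _ add[OF abs[OF fZ] pow]])
    show "(\<lambda>\<omega>. \<phi> (Z \<omega>)) \<in> borel_measurable M"
      by (rule measurable_compose[OF random_variable[OF Z] borel_measurable_continuous_onI[OF \<phi>]])
    show "\<bar>\<phi> (Z \<omega>)\<bar> \<le> \<bar>f (Z \<omega>)\<bar> + \<epsilon> * (1 + Z \<omega> ^ (2 * q))" for \<omega>
      using le[of "Z \<omega>"] by linarith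
  qed
  from E_diff_le[OF this H_Dom[OF fZ] H_Dom[OF pow] le]
  have "\<bar>E (\<lambda>\<omega>. \<phi> (Z \<omega>)) - E (\<lambda>\<omega>. f (Z \<omega>))\<bar> \<le> E (\<lambda>\<omega>. \<epsilon> * (1 + Z \<omega> ^ (2 * q)))" .
  also have "\<dots> = \<epsilon> * E (\<lambda>\<omega>. Z \<omega> ^ (2 * q) + 1)"
    using \<epsilon> by (subst add.commute) (intro E_scale H_Dom add const power_in_H Z)
  also have "E (\<lambda>\<omega>. Z \<omega> ^ (2 * q) + 1) = E (\<lambda>\<omega>. Z \<omega> ^ (2 * q)) + 1"
    by (intro E_add_const H_Dom power_in_H Z)
  finally show ?thesis by (simp add: add.commute)
qed

context centered_iid_sequence begin

lemma V_1_0: "V f n 1 0 = E (\<lambda>\<omega>. f (1 / sqrt (real n) * S n \<omega>))"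
  by (simp add: V_def W_def)

text \<open>
  Every subsequential limit of the rescaled functions solves the equation that characterises \<open>\<xi>\<close>,
  so by uniqueness they all agree at \<open>(1, 0)\<close>, which is convergence of the whole sequence.
\<close>

lemma bounded_Lipschitz_convergence:
  assumes f: "bounded_Lipschitz L B f"
    and \<xi>: "G_normal \<Q> \<xi> (- E (\<lambda>\<omega>. - (X 1 \<omega>)\<^sup>2)) (E (\<lambda>\<omega>. (X 1 \<omega>)\<^sup>2))"
  shows "(\<lambda>n. E (\<lambda>\<omega>. f (1 / sqrt (real n) * S n \<omega>))) \<longlonglongrightarrow> upper_expectation \<Q> (\<lambda>\<omega>. f (\<xi> \<omega>))"
proof -
  let ?u = "\<lambda>(t, x). upper_expectation \<Q> (\<lambda>\<omega>. f (x + sqrt t * \<xi> \<omega>))"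
  have "unique_viscosity_solution G f ?u"
    using \<xi>[unfolded G_normal_def] bounded_LipschitzD(5)[OF f] unfolding G_def by blast
  then have unique: "v (t, x) = ?u (t, x)"
    if "viscosity_solution G f v" "polynomial_growth v" "0 \<le> t" for v t x
    using that unfolding unique_viscosity_solution_def by blast
  have "(\<lambda>n. V f n 1 0) \<longlonglongrightarrow> ?u (1, 0)"
  proof (rule LIMSEQ_if_subsubsequences)
    fix r :: "nat \<Rightarrow> nat" assume r: "strict_mono r"
    show "\<exists>q. strict_mono q \<and> (\<lambda>i. V f (r (q i)) 1 0) \<longlonglongrightarrow> ?u (1, 0)"
    proof (rule V_subsequence[OF f r])
      fix q v assume mono: "strict_mono (q :: nat \<Rightarrow> nat)"
        and lim: "\<And>t x. 0 \<le> t \<Longrightarrow> (\<lambda>i. V f (r (q i)) t x) \<longlonglongrightarrow> v t x"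
      interpret scaling_limit M \<P> H X L B f "\<lambda>i. r (q i)" v
        using f lim strict_mono_o[OF r mono] by unfold_locales (auto simp: comp_def)
      have "v 1 0 = ?u (1, 0)"
        using unique[OF viscosity_solution_v polynomial_growth_v, of 1 0] by simp
      with lim[of 1 0] mono show ?thesis by (intro exI[of _ q]) simp
    qed
  qed
  then show ?thesis by (simp add: V_1_0)
qed

lemma normalized_even_power_bounded:
  obtains D where "0 \<le> D" "\<And>n. E (\<lambda>\<omega>. (1 / sqrt (real n) * S n \<omega>) ^ (2 * m)) \<le> D"
proof -
  obtain D where D: "0 \<le> D" "\<And>k. E (\<lambda>\<omega>. S k \<omega> ^ (2 * m)) \<le> D * real k ^ m"
    using E_even_power[of m] by blast
  have "E (\<lambda>\<omega>. (1 / sqrt (real n) * S n \<omega>) ^ (2 * m)) \<le> D" for n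
  proof -
    \<comment> \<open>the base is 1, except that it is 0 for \<open>n = 0\<close>\<close>
    have "((1 / sqrt (real n))\<^sup>2 * real n) ^ m \<le> 1"
      by (intro power_le_one) (auto simp: power_divide)
    then have "D * ((1 / sqrt (real n))\<^sup>2 * real n) ^ m \<le> D * 1" using D(1) by (rule mult_left_mono)
    with E_even_power_scaled[OF D(2), of "1 / sqrt (real n)" n] show ?thesis by linarith
  qed
  with D(1) that show thesis by blast
qed

end

theorem theorem3p2:
  fixes M :: "'a measure" and \<P> :: "'a measure set" and H :: "('a \<Rightarrow> real) set"
    and X :: "nat \<Rightarrow> 'a \<Rightarrow> real"
    and N :: "'b measure" and \<Q> :: "'b measure set" and K :: "('b \<Rightarrow> real) set"
    and \<xi> :: "'b \<Rightarrow> real"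
    and \<phi> :: "real \<Rightarrow> real"
  assumes "sublinear_expectation_space M \<P> H"
    and "\<forall>i\<ge>1. X i \<in> H"
    and "iid \<P> H X"
    and "upper_expectation \<P> (X 1) = 0"
    and "upper_expectation \<P> (\<lambda>\<omega>. - X 1 \<omega>) = 0"
    and "sublinear_expectation_space N \<Q> K"
    and "\<xi> \<in> K"
    and "G_normal \<Q> \<xi> (- upper_expectation \<P> (\<lambda>\<omega>. - (X 1 \<omega>)\<^sup>2))
                      (upper_expectation \<P> (\<lambda>\<omega>. (X 1 \<omega>)\<^sup>2))"
    and "continuous_on UNIV \<phi>"
    and "\<exists>C>0. \<exists>p\<ge>1. \<forall>x. \<bar>\<phi> x\<bar> \<le> C * (1 + \<bar>x\<bar> powr p)"
  shows "(\<lambda>n. upper_expectation \<P> (\<lambda>\<omega>. \<phi> (1 / sqrt (real n) * (\<Sum>i=1..n. X i \<omega>))))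
           \<longlonglongrightarrow> upper_expectation \<Q> (\<lambda>\<omega>. \<phi> (\<xi> \<omega>))"
proof -
  interpret P: sublinear_expectation_space M \<P> H by (rule assms(1))
  interpret P: centered_iid_sequence M \<P> H X
    using assms(2-5) by unfold_locales auto
  interpret Q: sublinear_expectation_space N \<Q> K by (rule assms(6))
  obtain C p where C: "0 < C" and growth: "\<And>x. \<bar>\<phi> x\<bar> \<le> C * (1 + \<bar>x\<bar> powr p)"
    using assms(10) by blast
  define q where "q = max 1 (nat \<lceil>p\<rceil>)"
  have q: "p \<le> real q" "1 \<le> q" unfolding q_def by linarith+
  define Z where "Z n \<omega> = 1 / sqrt (real n) * P.S n \<omega>" for n \<omega>
  have Z: "Z n \<in> H" for n unfolding Z_def[abs_def] by (intro P.scale P.S_in_H)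
  obtain D where D: "0 \<le> D" "\<And>n. P.E (\<lambda>\<omega>. Z n \<omega> ^ (2 * q)) \<le> D"
    using P.normalized_even_power_bounded[of q] unfolding Z_def by blast
  define m where "m = Q.E (\<lambda>\<omega>. \<xi> \<omega> ^ (2 * q))"
  \<comment> \<open>the sum of \<open>1 + D\<close> and \<open>1 + |m|\<close>, the moment factors of the two approximation errors\<close>
  define c where "c = 2 + D + \<bar>m\<bar>"
  have c: "0 < c" using D(1) by (simp add: c_def)
  have "(\<lambda>n. P.E (\<lambda>\<omega>. \<phi> (Z n \<omega>))) \<longlonglongrightarrow> Q.E (\<lambda>\<omega>. \<phi> (\<xi> \<omega>))"
  proof (rule tendstoI)
    fix e :: real assume e: "0 < e"
    define \<epsilon> where "\<epsilon> = e / (2 * c)"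
    have \<epsilon>: "0 < \<epsilon>" "\<epsilon> * c = e / 2" using e c by (auto simp: \<epsilon>_def)
    obtain f L B where f: "bounded_Lipschitz L B f"
      and le: "\<And>x. \<bar>\<phi> x - f x\<bar> \<le> \<epsilon> * (1 + x ^ (2 * q))"
      using bounded_Lipschitz_approximation[OF assms(9) growth C q \<epsilon>(1)] by auto
    have approx: "\<bar>P.E (\<lambda>\<omega>. \<phi> (Z n \<omega>)) - P.E (\<lambda>\<omega>. f (Z n \<omega>))\<bar> \<le> \<epsilon> * (1 + D)" for n
    proof -
      have "\<epsilon> * (1 + P.E (\<lambda>\<omega>. Z n \<omega> ^ (2 * q))) \<le> \<epsilon> * (1 + D)"
        using D(2)[of n] \<epsilon>(1) by (intro mult_left_mono) auto
      with P.E_approximation[OF Z assms(9) bounded_LipschitzD(5)[OF f] less_imp_le[OF \<epsilon>(1)] le]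
      show ?thesis by (rule order_trans)
    qed
    have approx\<xi>: "\<bar>Q.E (\<lambda>\<omega>. \<phi> (\<xi> \<omega>)) - Q.E (\<lambda>\<omega>. f (\<xi> \<omega>))\<bar> \<le> \<epsilon> * (1 + \<bar>m\<bar>)"
    proof -
      have "\<epsilon> * (1 + m) \<le> \<epsilon> * (1 + \<bar>m\<bar>)" using \<epsilon>(1) by (intro mult_left_mono) auto
      with Q.E_approximation[OF assms(7,9) bounded_LipschitzD(5)[OF f] less_imp_le[OF \<epsilon>(1)] le]
      show ?thesis unfolding m_def by (rule order_trans)
    qed
    have sum: "\<epsilon> * (1 + D) + \<epsilon> * (1 + \<bar>m\<bar>) = e / 2"
      using \<epsilon>(2) unfolding c_def by (simp add: algebra_simps)
    have "(\<lambda>n. P.E (\<lambda>\<omega>. f (Z n \<omega>))) \<longlonglongrightarrow> Q.E (\<lambda>\<omega>. f (\<xi> \<omega>))"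
      using P.bounded_Lipschitz_convergence[OF f assms(8)] by (simp add: Z_def)
    from tendstoD[OF this, of "e / 2"] e
    have "\<forall>\<^sub>F n in sequentially. \<bar>P.E (\<lambda>\<omega>. f (Z n \<omega>)) - Q.E (\<lambda>\<omega>. f (\<xi> \<omega>))\<bar> < e / 2"
      by (simp add: dist_real_def)
    then show "\<forall>\<^sub>F n in sequentially. dist (P.E (\<lambda>\<omega>. \<phi> (Z n \<omega>))) (Q.E (\<lambda>\<omega>. \<phi> (\<xi> \<omega>))) < e"
    proof eventually_elim
      case (elim n)
      then show ?case using approx[of n] approx\<xi> sum unfolding dist_real_def by linarith
    qed
  qed
  then show ?thesis by (simp add: Z_def P.S_def)
qed

end
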